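(* Let $k\ge1$ and let $r\mapsto f_r$ be a $C^k$-foliation of $\mathbb{A}$ in graphs. Then there exists a $C^{k-1}$ exact symplectic diffeomorphism $\Phi:\mathbb{A}\to\mathbb{A}$ of the form $\Phi(\theta,r)=\big(h(\theta,r),\eta(h(\theta,r),r)\big)$ such that for each $r\in\mathbb{R}$ the set $\{(\theta,\eta(\theta,r)):\theta\in\mathbb{T}\}$ is a leaf of the foliation.
   Context: $\mathbb{T}=\mathbb{R}/\mathbb{Z}$, $\mathbb{A}=\mathbb{T}\times\mathbb{R}$ with symplectic form $-d(r\,d\theta)$. A map $a\in\mathbb{R}\mapsto f_a$ (with $f_a:\mathbb{T}\to\mathbb{R}$) defines a $C^k$ foliation in graphs if $(\theta,a)\mapsto(\theta,f_a(\theta))$ is a $C^k$ diffeomorphism of $\mathbb{A}$; its leaves are the graphs of the $f_a$. A $C^0$ diffeomorphism is a homeomorphism. A diffeomorphism $\phi:\mathbb{A}\to\mathbb{A}$ is exact symplectic if $\phi^*(r\,d\theta)-r\,d\theta$ is exact; when $k-1=0$, a $C^0$ exact symplectic diffeomorphism means an exact symplectic homeomorphism, i.e. a homeomorphism that is a limit, for the $C^0$ compact-open topology, of a sequence of exact symplectic diffeomorphisms. *)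

theory Defs
  imports "HOL-Analysis.Analysis"
begin

section \<open>The circle and the annulus\<close>

quotient_type circle = real / "\<lambda>x y. x - y \<in> \<int>"
  morphisms rep_circle to_circle
proof (rule equivpI)
  show "reflp (\<lambda>x y::real. x - y \<in> \<int>)"
    by (auto simp: reflp_def)
  show "symp (\<lambda>x y::real. x - y \<in> \<int>)"
    by (auto simp: symp_def) (metis Ints_minus minus_diff_eq)
  show "transp (\<lambda>x y::real. x - y \<in> \<int>)"
    by (auto simp: transp_def) (metis Ints_add diff_add_cancel add_diff_eq)
qed

text \<open>The circle carries the quotient topology.\<close>

instantiation circle :: topological_space
begin

definition open_circle :: "circle set \<Rightarrow> bool"
  where "open_circle U \<longleftrightarrow> open (to_circle -` U)"

instance
  by standard (auto simp: open_circle_def vimage_Union)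

end

type_synonym annulus = "circle \<times> real"

definition cover :: "real \<times> real \<Rightarrow> annulus"
  where "cover = (\<lambda>(x, r). (to_circle x, r))"

section \<open>Differentiability\<close>

primrec Ck_on :: "nat \<Rightarrow> 'a::real_normed_vector set \<Rightarrow> ('a \<Rightarrow> 'b::real_normed_vector) \<Rightarrow> bool" where
  "Ck_on 0 U F \<longleftrightarrow> continuous_on U F"
| "Ck_on (Suc k) U F \<longleftrightarrow>
     (\<forall>x\<in>U. F differentiable (at x)) \<and>
     (\<forall>v. Ck_on k U (\<lambda>x. frechet_derivative F (at x) v))"

text \<open>
  The local inverses of \<^const>\<open>cover\<close> are the charts of the annulus. A map of the annulus is
  therefore \<open>C\<^sup>k\<close> iff near every point it is represented by a \<open>C\<^sup>k\<close> map of the plane.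
\<close>

definition Ck_map :: "nat \<Rightarrow> (annulus \<Rightarrow> annulus) \<Rightarrow> bool"
  where "Ck_map k \<phi> \<longleftrightarrow>
    (\<forall>w. \<exists>U F. open U \<and> w \<in> U \<and> Ck_on k U F \<and> (\<forall>u\<in>U. \<phi> (cover u) = cover (F u)))"

definition Ck_diffeo :: "nat \<Rightarrow> (annulus \<Rightarrow> annulus) \<Rightarrow> bool"
  where "Ck_diffeo k \<phi> \<longleftrightarrow> bij \<phi> \<and> Ck_map k \<phi> \<and> Ck_map k (inv \<phi>)"

text \<open>
  The tangent bundle of the annulus is identified with \<open>annulus \<times> \<real>\<^sup>2\<close> by means of
  the coordinates \<open>(\<theta>, r)\<close>; the tangent map is the derivative of a local representative.
\<close>

definition has_annulus_derivative ::
  "(annulus \<Rightarrow> annulus) \<Rightarrow> (real \<times> real \<Rightarrow> real \<times> real) \<Rightarrow> annulus \<Rightarrow> bool"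
  where "has_annulus_derivative \<phi> D z \<longleftrightarrow>
    (\<exists>w F. cover w = z \<and> (\<forall>\<^sub>F u in nhds w. \<phi> (cover u) = cover (F u)) \<and>
           (F has_derivative D) (at w))"

definition annulus_derivative ::
  "(annulus \<Rightarrow> annulus) \<Rightarrow> annulus \<Rightarrow> real \<times> real \<Rightarrow> real \<times> real"
  where "annulus_derivative \<phi> z = (THE D. has_annulus_derivative \<phi> D z)"

section \<open>Exact symplectic maps\<close>

type_synonym one_form = "annulus \<Rightarrow> real \<times> real \<Rightarrow> real"

text \<open>The form \<open>r d\<theta>\<close>.\<close>

definition liouville :: one_form
  where "liouville = (\<lambda>(\<theta>, r) (v\<^sub>\<theta>, v\<^sub>r). r * v\<^sub>\<theta>)"

definition pullback :: "(annulus \<Rightarrow> annulus) \<Rightarrow> one_form \<Rightarrow> one_form"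
  where "pullback \<phi> \<omega> = (\<lambda>z v. \<omega> (\<phi> z) (annulus_derivative \<phi> z v))"

text \<open>
  The primitive \<open>S\<close> is a function on the annulus, not merely on its universal cover.
\<close>

definition exact_form :: "one_form \<Rightarrow> bool"
  where "exact_form \<omega> \<longleftrightarrow>
    (\<exists>S :: annulus \<Rightarrow> real. \<forall>w. ((\<lambda>u. S (cover u)) has_derivative \<omega> (cover w)) (at w))"

definition exact_symplectic :: "(annulus \<Rightarrow> annulus) \<Rightarrow> bool"
  where "exact_symplectic \<phi> \<longleftrightarrow>
    exact_form (\<lambda>z v. pullback \<phi> liouville z v - liouville z v)"

definition compact_open_topology ::
  "('a::topological_space \<Rightarrow> 'b::topological_space) topology"
  where "compact_open_topology =
    topology_generated_by
      {{f. continuous_on UNIV f \<and> f ` K \<subseteq> U} | K U. compact K \<and> open U}"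

text \<open>The approximating diffeomorphisms are of class \<open>C\<^sup>1\<close>.\<close>

definition exact_symplectic_homeo :: "(annulus \<Rightarrow> annulus) \<Rightarrow> bool"
  where "exact_symplectic_homeo \<phi> \<longleftrightarrow>
    homeomorphism UNIV UNIV \<phi> (inv \<phi>) \<and>
    (\<exists>\<psi> :: nat \<Rightarrow> annulus \<Rightarrow> annulus.
       (\<forall>n. Ck_diffeo 1 (\<psi> n) \<and> exact_symplectic (\<psi> n)) \<and>
       limitin compact_open_topology \<psi> \<phi> sequentially)"

definition exact_symplectic_Ck_diffeo :: "nat \<Rightarrow> (annulus \<Rightarrow> annulus) \<Rightarrow> bool"
  where "exact_symplectic_Ck_diffeo k \<phi> \<longleftrightarrow>
    (if k = 0 then exact_symplectic_homeo \<phi> else Ck_diffeo k \<phi> \<and> exact_symplectic \<phi>)"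

section \<open>Foliations in graphs\<close>

definition Ck_foliation_in_graphs :: "nat \<Rightarrow> (real \<Rightarrow> circle \<Rightarrow> real) \<Rightarrow> bool"
  where "Ck_foliation_in_graphs k f \<longleftrightarrow> Ck_diffeo k (\<lambda>(\<theta>, a). (\<theta>, f a \<theta>))"

definition graph :: "(circle \<Rightarrow> real) \<Rightarrow> annulus set"
  where "graph g = {(\<theta>, g \<theta>) | \<theta>. True}"

definition leaves :: "(real \<Rightarrow> circle \<Rightarrow> real) \<Rightarrow> annulus set set"
  where "leaves f = {graph (f a) | a. True}"

section \<open>Coherence of the definitions\<close>

lemma to_circle_eq_iff: "to_circle x = to_circle y \<longleftrightarrow> x - y \<in> \<int>"
  by (rule circle.abs_eq_iff)

lemma cover_eq_iff: "cover u = cover w \<longleftrightarrow> fst u - fst w \<in> \<int> \<and> snd u = snd w"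
  by (auto simp: cover_def to_circle_eq_iff split: prod.splits)

lemma surj_cover: "\<exists>w. cover w = z"
proof -
  obtain \<theta> r where z: "z = (\<theta>, r)" by fastforce
  obtain x where "to_circle x = \<theta>"
    by (metis Quotient_circle Quotient_abs_rep)
  then show ?thesis by (intro exI[of _ "(x, r)"]) (simp add: cover_def z)
qed

lemma continuous_to_circle: "continuous_on UNIV to_circle"
  by (simp add: continuous_on_open_vimage open_circle_def)

lemma continuous_cover: "continuous_on UNIV cover"
  unfolding cover_def case_prod_beta
  by (intro continuous_on_Pair continuous_on_snd continuous_on_id
      continuous_on_compose2[OF continuous_to_circle] continuous_on_fst) auto

lemma open_to_circle_image:
  assumes "open V" shows "open (to_circle ` V)"
proof -
  have "to_circle -` (to_circle ` V) = (\<Union>n\<in>\<int>. (\<lambda>x. n + x) ` V)"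
  proof (intro equalityI subsetI)
    fix x assume "x \<in> to_circle -` (to_circle ` V)"
    then obtain y where "y \<in> V" "x - y \<in> \<int>"
      by (auto simp: to_circle_eq_iff)
    then show "x \<in> (\<Union>n\<in>\<int>. (\<lambda>x. n + x) ` V)"
      by (intro UN_I[of "x - y"] image_eqI[of _ _ y]) auto
  next
    fix x assume "x \<in> (\<Union>n\<in>\<int>. (\<lambda>x. n + x) ` V)"
    then obtain n y where ny: "n \<in> \<int>" "y \<in> V" "x = n + y" by auto
    then have "to_circle x = to_circle y" by (simp add: to_circle_eq_iff)
    with ny(2) show "x \<in> to_circle -` (to_circle ` V)" by auto
  qed
  then show ?thesis
    using assms by (auto simp: open_circle_def intro!: open_UN open_translation)
qed

lemma open_cover_image:
  assumes "open V" shows "open (cover ` V)"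
  unfolding open_prod_def
proof
  fix p assume "p \<in> cover ` V"
  then obtain w where w: "w \<in> V" "p = cover w" by blast
  obtain A B where AB: "open A" "open B" "w \<in> A \<times> B" "A \<times> B \<subseteq> V"
    using open_prod_elim[OF assms w(1)] by blast
  have "(to_circle ` A) \<times> B \<subseteq> cover ` V"
  proof
    fix q assume "q \<in> (to_circle ` A) \<times> B"
    then obtain x r where "x \<in> A" "r \<in> B" "q = cover (x, r)" by (auto simp: cover_def)
    with AB(4) show "q \<in> cover ` V" by blast
  qed
  moreover have "p \<in> (to_circle ` A) \<times> B"
    using AB(3) w(2) by (auto simp: cover_def)
  ultimately show "\<exists>A B. open A \<and> open B \<and> p \<in> A \<times> B \<and> A \<times> B \<subseteq> cover ` V"
    using AB(1,2) open_to_circle_image by blast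
qed

lemma has_annulus_derivative_unique:
  assumes "has_annulus_derivative \<phi> D z" "has_annulus_derivative \<phi> D' z"
  shows "D = D'"
proof -
  obtain w F where F: "cover w = z" "\<forall>\<^sub>F u in nhds w. \<phi> (cover u) = cover (F u)"
      "(F has_derivative D) (at w)"
    using assms(1) by (auto simp: has_annulus_derivative_def)
  obtain w' F' where F': "cover w' = z" "\<forall>\<^sub>F u in nhds w'. \<phi> (cover u) = cover (F' u)"
      "(F' has_derivative D') (at w')"
    using assms(2) by (auto simp: has_annulus_derivative_def)
  define c where "c = w' - w"
  define G where "G = (\<lambda>u. F' (u + c))"
  have c: "cover (u + c) = cover u" for u
    using F(1) F'(1) cover_eq_iff[of w' w] by (simp add: c_def cover_eq_iff)
  have lim: "filterlim (\<lambda>u. u + c) (nhds w') (nhds w)"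
    using isCont_add[OF continuous_ident continuous_const, of w c]
    by (simp add: continuous_within c_def tendsto_nhds_iff add.commute)
  have evG: "\<forall>\<^sub>F u in nhds w. \<phi> (cover u) = cover (G u)"
    using eventually_compose_filterlim[OF F'(2) lim] by (simp add: G_def c)
  have "((\<lambda>u. u + c) has_derivative (\<lambda>v. v)) (at w)"
    by (auto intro!: derivative_eq_intros)
  then have dG: "(G has_derivative D') (at w)"
    unfolding G_def using has_derivative_compose[of "\<lambda>u. u + c" "\<lambda>v. v" w UNIV F' D'] F'(3)
    by (simp add: c_def)
  define H where "H = (\<lambda>u. F u - G u)"
  have dH: "(H has_derivative (\<lambda>v. D v - D' v)) (at w)"
    unfolding H_def by (intro has_derivative_diff F(3) dG)
  have ev: "\<forall>\<^sub>F u in nhds w. fst (H u) \<in> \<int> \<and> snd (H u) = 0"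
    using F(2) evG by eventually_elim (simp add: H_def flip: cover_eq_iff)
  have "isCont (\<lambda>u. fst (H u)) w"
    using has_derivative_continuous[OF dH] by (intro continuous_intros)
  then have "\<forall>\<^sub>F u in nhds w. dist (fst (H u)) (fst (H w)) < 1"
    by (simp add: continuous_within tendsto_iff tendsto_nhds_iff eventually_at_filter)
      (auto elim!: allE[of _ 1] eventually_mono)
  then have "\<forall>\<^sub>F u in nhds w. H u = H w"
    using ev
  proof eventually_elim
    case (elim u)
    moreover have "fst (H w) \<in> \<int> \<and> snd (H w) = 0"
      using ev by (rule eventually_nhds_x_imp_x)
    ultimately show ?case
      using Ints_eq_abs_less1[of "fst (H u)" "fst (H w)"]
      by (auto simp: dist_real_def prod_eq_iff)
  qed
  then have "\<forall>\<^sub>F u in at w. H w = H u"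
    unfolding eventually_at_filter by (rule eventually_mono) simp
  then have "(H has_derivative (\<lambda>v. 0)) (at w)"
    by (rule has_derivative_transform_eventually[OF has_derivative_const]) auto
  with dH have "(\<lambda>v. D v - D' v) = (\<lambda>v. 0)"
    by (rule has_derivative_unique)
  then show ?thesis by (metis eq_iff_diff_eq_0 ext)
qed

lemma annulus_derivative_eq:
  "has_annulus_derivative \<phi> D z \<Longrightarrow> annulus_derivative \<phi> z = D"
  unfolding annulus_derivative_def
  by (blast intro: the_equality has_annulus_derivative_unique)

lemma Ck_map_0_iff: "Ck_map 0 \<phi> \<longleftrightarrow> continuous_on UNIV \<phi>"
proof
  assume L: "Ck_map 0 \<phi>"
  have *: "\<phi> -` W = (\<Union>{V. open V \<and> V \<subseteq> \<phi> -` W})" if W: "open W" for W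
  proof (intro equalityI subsetI)
    fix z assume z: "z \<in> \<phi> -` W"
    obtain w where w: "cover w = z" using surj_cover by blast
    obtain U F where UF: "open U" "w \<in> U" "continuous_on U F"
        "\<forall>u\<in>U. \<phi> (cover u) = cover (F u)"
      using L unfolding Ck_map_def Ck_on.simps by blast
    have "continuous_on U (\<lambda>u. \<phi> (cover u))"
      using continuous_on_compose2[OF continuous_cover UF(3)] UF(4)
      by (simp cong: continuous_on_cong)
    then have "open ((\<lambda>u. \<phi> (cover u)) -` W \<inter> U)"
      using W UF(1) continuous_on_open_vimage by blast
    then have "open (cover ` ((\<lambda>u. \<phi> (cover u)) -` W \<inter> U))" by (rule open_cover_image)
    moreover have "z \<in> cover ` ((\<lambda>u. \<phi> (cover u)) -` W \<inter> U)"
      using z w UF(2) by auto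
    ultimately show "z \<in> \<Union>{V. open V \<and> V \<subseteq> \<phi> -` W}" by blast
  qed auto
  show "continuous_on UNIV \<phi>"
  proof (subst continuous_on_open_vimage[OF open_UNIV], intro allI impI)
    fix W :: "annulus set" assume "open W"
    have "open (\<Union>{V. open V \<and> V \<subseteq> \<phi> -` W})" by (intro open_Union) auto
    with *[OF \<open>open W\<close>] show "open (\<phi> -` W \<inter> UNIV)" by simp
  qed
next
  assume cont: "continuous_on UNIV \<phi>"
  show "Ck_map 0 \<phi>"
    unfolding Ck_map_def Ck_on.simps
  proof
    fix w
    obtain y where y: "cover y = \<phi> (cover w)" using surj_cover by blast
    define B where "B = {fst y - 1/2<..<fst y + 1/2} \<times> (UNIV :: real set)"
    have B: "open B" by (simp add: B_def open_Times)
    have inj: "inj_on cover B"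
    proof (rule inj_onI)
      fix u v assume uv: "u \<in> B" "v \<in> B" "cover u = cover v"
      then have "fst u - fst v \<in> \<int>" "\<bar>fst u - fst v\<bar> < 1" "snd u = snd v"
        by (auto simp: B_def cover_eq_iff mem_Times_iff abs_less_iff)
      then have "fst u = fst v"
        using Ints_nonzero_abs_less1[of "fst u - fst v"] by simp
      with \<open>snd u = snd v\<close> show "u = v" by (simp add: prod_eq_iff)
    qed
    obtain g where g: "homeomorphism B (cover ` B) cover g"
    proof (rule homeomorphism_injective_open_map[of B cover "cover ` B"])
      show "continuous_on B cover"
        using continuous_cover continuous_on_subset by blast
      show "openin (top_of_set (cover ` B)) (cover ` V)" if "openin (top_of_set B) V" for V
        using that B open_cover_image by (auto simp: openin_open_eq)
    qed (use inj in auto)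
    define U where "U = (\<lambda>u. \<phi> (cover u)) -` (cover ` B)"
    have c: "continuous_on UNIV (\<lambda>u. \<phi> (cover u))"
      using continuous_on_compose2[OF cont continuous_cover] by simp
    have "open U" unfolding U_def
      by (rule open_vimage[OF open_cover_image[OF B] c])
    moreover have "w \<in> U"
    proof -
      have "y \<in> B" by (simp add: B_def mem_Times_iff)
      then have "cover y \<in> cover ` B" by (rule imageI)
      then show ?thesis by (simp add: U_def y)
    qed
    moreover have "continuous_on U (\<lambda>u. g (\<phi> (cover u)))"
    proof (rule continuous_on_compose2[of "cover ` B" g U "\<lambda>u. \<phi> (cover u)"])
      show "continuous_on (cover ` B) g" using g by (simp add: homeomorphism_def)
      show "continuous_on U (\<lambda>u. \<phi> (cover u))"
        using c continuous_on_subset by blast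
      show "(\<lambda>u. \<phi> (cover u)) ` U \<subseteq> cover ` B" unfolding U_def by (rule image_vimage_subset)
    qed
    moreover have "\<phi> (cover u) = cover (g (\<phi> (cover u)))" if "u \<in> U" for u
    proof -
      have "\<phi> (cover u) \<in> cover ` B" using that by (simp add: U_def)
      from homeomorphism_apply2[OF g this] show ?thesis by simp
    qed
    ultimately show "\<exists>U F. open U \<and> w \<in> U \<and> continuous_on U F \<and>
        (\<forall>u\<in>U. \<phi> (cover u) = cover (F u))"
      by (intro exI[of _ U] exI[of _ "\<lambda>u. g (\<phi> (cover u))"] conjI ballI)
  qed
qed

lemma Ck_diffeo_0_iff: "Ck_diffeo 0 \<phi> \<longleftrightarrow> homeomorphism UNIV UNIV \<phi> (inv \<phi>)"
proof
  assume "Ck_diffeo 0 \<phi>"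
  then have "bij \<phi>" "continuous_on UNIV \<phi>" "continuous_on UNIV (inv \<phi>)"
    by (simp_all add: Ck_diffeo_def Ck_map_0_iff)
  then show "homeomorphism UNIV UNIV \<phi> (inv \<phi>)"
    using bij_imp_bij_inv[of \<phi>]
    by (simp add: homeomorphism_def bij_is_surj bij_is_inj inv_f_f surj_f_inv_f)
next
  assume "homeomorphism UNIV UNIV \<phi> (inv \<phi>)"
  then show "Ck_diffeo 0 \<phi>"
    unfolding Ck_diffeo_def Ck_map_0_iff homeomorphism_def
    by (intro conjI bijI inj_on_inverseI[of _ "inv \<phi>"]) auto
qed

end

theory Submission
  imports Defs
begin

text \<open>
  The leaf of index \<open>a\<close> has the mean height \<open>\<integral> f a\<close>, and the mean height is a
  diffeomorphism of the line. Let \<open>\<eta>(\<cdot>, r)\<close> be the leaf of mean height \<open>r\<close>, lifted to a 1-periodic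
  function on the line. Put \<open>U(x, r) = \<integral>\<^sub>0\<^sup>x \<eta>(t, r) dt\<close> and \<open>g = \<partial>U/\<partial>r\<close>, so that
  \<open>\<partial>g/\<partial>x = \<partial>\<eta>/\<partial>r > 0\<close>. Since the leaf has mean \<open>r\<close>, \<open>U(x + 1, r) = U(x, r) + r\<close>; hence
  \<open>g(x + 1, r) = g(x, r) + 1\<close>, and \<open>U\<close> is the generating function of a map
    \<open>\<Phi> : (g(x, r), r) \<mapsto> (x, \<eta>(x, r))\<close>
  of the annulus, which sends circles \<open>r = const\<close> to leaves. In the coordinates \<open>(x, r)\<close> the form
  \<open>\<Phi>\<^sup>*(r d\<theta>) - r d\<theta>\<close> is \<open>\<eta> dx - r dg = dU - g dr - r dg = d(U - r g)\<close>, and \<open>U - r g\<close> is 1-periodic in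
  \<open>x\<close>; so \<open>\<Phi>\<close> is exact symplectic. Only \<open>g\<close>, which involves a derivative of \<open>\<eta>\<close> in \<open>r\<close>, costs one
  degree of smoothness.

  For \<open>k = 1\<close> the function \<open>g\<close> is in general only continuous, the computation above makes no
  sense, and \<open>\<Phi>\<close> has to be approximated. Average \<open>U\<close> over vertical segments of length \<open>2\<epsilon>\<close>. The averaged function
  still satisfies \<open>U(x + 1, r) = U(x, r) + r\<close>, because the average of \<open>r\<close> over a centred segment is
  \<open>r\<close>; its two derivatives are an average of \<open>\<eta>\<close> and a difference quotient of \<open>U\<close> itself, both
  \<open>C\<^sup>1\<close>. So it generates a \<open>C\<^sup>1\<close> exact symplectic diffeomorphism, and the mean value theorem shows
  that these diffeomorphisms converge to \<open>\<Phi>\<close> locally uniformly as \<open>\<epsilon> \<rightarrow> 0\<close>.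

  The argument is carried by the locale \<open>generating_function\<close>: \<open>exact_symplectic_twist\<close> is the
  computation of the primitive, \<open>generating_function_average\<close> and \<open>tendsto_twist_average\<close> are the
  approximation, and \<open>foliation_generating_function\<close> produces \<open>U\<close> from the foliation.
\<close>

section \<open>Maps of class \<open>C\<^sup>k\<close>\<close>

lemma Ck_on_cong:
  assumes "open U" "\<And>x. x \<in> U \<Longrightarrow> F x = G x" "Ck_on k U F"
  shows "Ck_on k U G"
  using assms(2,3)
proof (induction k arbitrary: F G)
  case 0
  then show ?case by (simp cong: continuous_on_cong)
next
  case (Suc k)
  have D: "(G has_derivative frechet_derivative F (at x)) (at x)" if "x \<in> U" for x
    using Suc.prems that assms(1)
    by (intro has_derivative_transform_within_open[of F _ x UNIV U G])
      (auto simp: frechet_derivative_works)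
  have "Ck_on k U (\<lambda>x. frechet_derivative G (at x) v)" for v
  proof (rule Suc.IH)
    show "Ck_on k U (\<lambda>x. frechet_derivative F (at x) v)" using Suc.prems by simp
    show "frechet_derivative F (at x) v = frechet_derivative G (at x) v" if "x \<in> U" for x
      using frechet_derivative_at[OF D[OF that]] by simp
  qed
  then show ?case using D by (auto simp: differentiable_def)
qed

lemma Ck_on_locally:
  assumes "\<And>w. w \<in> U \<Longrightarrow> \<exists>V. open V \<and> w \<in> V \<and> Ck_on k V F"
  shows "Ck_on k U F"
  using assms
proof (induction k arbitrary: F)
  case 0
  have "isCont F w" if "w \<in> U" for w
    using 0[OF that] continuous_on_eq_continuous_at by auto
  then show ?case by (simp add: continuous_at_imp_continuous_on)
next
  case (Suc k)
  have "Ck_on k U (\<lambda>x. frechet_derivative F (at x) v)" for v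
    using Suc.prems by (intro Suc.IH) fastforce
  moreover have "F differentiable (at x)" if "x \<in> U" for x
    using Suc.prems[OF that] by auto
  ultimately show ?case by simp
qed

lemma Ck_on_bounded_linear:
  assumes "open U" "bounded_linear L" "Ck_on k U F"
  shows "Ck_on k U (\<lambda>x. L (F x))"
  using assms(3)
proof (induction k arbitrary: F)
  case 0
  then show ?case
    using bounded_linear.continuous_on[OF assms(2)] by simp
next
  case (Suc k)
  have D: "((\<lambda>x. L (F x)) has_derivative (\<lambda>v. L (frechet_derivative F (at x) v))) (at x)"
    if "x \<in> U" for x
    using Suc.prems that
    by (intro bounded_linear.has_derivative[OF assms(2)]) (simp add: frechet_derivative_works)
  have "Ck_on k U (\<lambda>x. frechet_derivative (\<lambda>x. L (F x)) (at x) v)" for v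
  proof (rule Ck_on_cong[OF assms(1)])
    show "Ck_on k U (\<lambda>x. L (frechet_derivative F (at x) v))"
      using Suc.prems by (intro Suc.IH) simp
    show "L (frechet_derivative F (at x) v) = frechet_derivative (\<lambda>x. L (F x)) (at x) v"
      if "x \<in> U" for x
      using fun_cong[OF frechet_derivative_at[OF D[OF that]], of v] by simp
  qed
  then show ?case using D by (auto simp: differentiable_def)
qed

lemma Ck_on_Pair:
  assumes "open U" "Ck_on k U F" "Ck_on k U G"
  shows "Ck_on k U (\<lambda>x. (F x, G x))"
  using assms(2,3)
proof (induction k arbitrary: F G)
  case 0
  then show ?case by (auto intro: continuous_on_Pair)
next
  case (Suc k)
  have D: "((\<lambda>x. (F x, G x)) has_derivative
      (\<lambda>v. (frechet_derivative F (at x) v, frechet_derivative G (at x) v))) (at x)"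
    if "x \<in> U" for x
    using Suc.prems that by (intro has_derivative_Pair) (simp_all add: frechet_derivative_works)
  have "Ck_on k U (\<lambda>x. frechet_derivative (\<lambda>x. (F x, G x)) (at x) v)" for v
  proof (rule Ck_on_cong[OF assms(1)])
    show "Ck_on k U (\<lambda>x. (frechet_derivative F (at x) v, frechet_derivative G (at x) v))"
      using Suc.prems by (intro Suc.IH) simp_all
    show "(frechet_derivative F (at x) v, frechet_derivative G (at x) v) =
        frechet_derivative (\<lambda>x. (F x, G x)) (at x) v" if "x \<in> U" for x
      using fun_cong[OF frechet_derivative_at[OF D[OF that]], of v] by simp
  qed
  then show ?case using D by (auto simp: differentiable_def)
qed

abbreviation Ck :: "nat \<Rightarrow> (real \<times> real \<Rightarrow> 'b::real_normed_vector) \<Rightarrow> bool"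
  where "Ck k \<equiv> Ck_on k UNIV"

text \<open>
  Since \<^const>\<open>Ck_on\<close> differentiates in every direction, inductions on \<open>k\<close> are awkward with it.
  On the plane it suffices to follow the two partial derivatives, which are again scalar
  functions: see \<open>Ck_SucI\<close> and \<open>Ck_SucE\<close>, on which all later inductions on \<open>k\<close> rest.
\<close>
definition has_partials ::
  "(real \<times> real \<Rightarrow> real) \<Rightarrow> (real \<times> real \<Rightarrow> real) \<Rightarrow> (real \<times> real \<Rightarrow> real) \<Rightarrow> bool"
  where "has_partials \<phi> p q \<longleftrightarrow>
    (\<forall>z. (\<phi> has_derivative (\<lambda>v. fst v * p z + snd v * q z)) (at z))"

lemma has_partialsD:
  "has_partials \<phi> p q \<Longrightarrow> (\<phi> has_derivative (\<lambda>v. fst v * p z + snd v * q z)) (at z)"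
  unfolding has_partials_def by blast

lemma has_partials_x:
  assumes "has_partials \<phi> p q"
  shows "((\<lambda>x. \<phi> (x, r)) has_real_derivative p (x, r)) (at x)"
proof -
  have "((\<lambda>x. (x, r)) has_derivative (\<lambda>v. (v, 0))) (at x)"
    by (auto intro!: derivative_eq_intros)
  from has_derivative_compose[OF this has_partialsD[OF assms]] show ?thesis
    by (simp add: has_field_derivative_def mult_commute_abs)
qed

lemma has_partials_r:
  assumes "has_partials \<phi> p q"
  shows "((\<lambda>r. \<phi> (x, r)) has_real_derivative q (x, r)) (at r)"
proof -
  have "((\<lambda>r. (x, r)) has_derivative (\<lambda>v. (0, v))) (at r)"
    by (auto intro!: derivative_eq_intros)
  from has_derivative_compose[OF this has_partialsD[OF assms]] show ?thesis
    by (simp add: has_field_derivative_def mult_commute_abs)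
qed

text \<open>
  A function with both partial derivatives is totally differentiable as soon as one of them is
  continuous.
\<close>
lemma has_partialsI:
  assumes x: "\<And>x r. ((\<lambda>x. \<phi> (x, r)) has_real_derivative p (x, r)) (at x)"
    and r: "\<And>x r. ((\<lambda>r. \<phi> (x, r)) has_real_derivative q (x, r)) (at r)"
    and cont: "continuous_on UNIV q"
  shows "has_partials \<phi> p q"
  unfolding has_partials_def
proof safe
  fix x r :: real
  have c: "((\<lambda>(x, r). blinfun_mult_right (q (x, r))) \<longlongrightarrow> blinfun_mult_right (q (x, r)))
      (at (x, r) within UNIV \<times> UNIV)"
    unfolding case_prod_beta prod.collapse
    using cont by (intro tendsto_intros bounded_linear.tendsto[OF bounded_linear_blinfun_mult_right])
      (auto simp: continuous_on_def)
  have "((\<lambda>(x, r). \<phi> (x, r)) has_derivative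
      (\<lambda>(tx, ty). p (x, r) * tx + blinfun_apply (blinfun_mult_right (q (x, r))) ty))
      (at (x, r) within UNIV \<times> UNIV)"
    using x r c
    by (intro has_derivative_partialsI[where fy = "\<lambda>x r. blinfun_mult_right (q (x, r))"])
      (auto simp: has_field_derivative_def continuous_within
      intro: tendsto_within_subset)
  then show "(\<phi> has_derivative (\<lambda>v. fst v * p (x, r) + snd v * q (x, r))) (at (x, r))"
    by (simp add: case_prod_beta' mult.commute)
qed

lemma Ck_lincomb:
  fixes p q :: "real \<times> real \<Rightarrow> real"
  assumes "Ck k p" "Ck k q"
  shows "Ck k (\<lambda>z. a * p z + b * q z)"
proof -
  have "bounded_linear (\<lambda>u::real \<times> real. a * fst u + b * snd u)"
    by (intro bounded_linear_intros)
  from Ck_on_bounded_linear[OF open_UNIV this Ck_on_Pair[OF open_UNIV assms]] show ?thesis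
    by simp
qed

lemma Ck_SucI:
  assumes "has_partials \<phi> p q" "Ck k p" "Ck k q"
  shows "Ck (Suc k) \<phi>"
proof -
  have "frechet_derivative \<phi> (at z) v = fst v * p z + snd v * q z" for z v
    using fun_cong[OF frechet_derivative_at[OF has_partialsD[OF assms(1), of z]], of v] by simp
  then have "Ck k (\<lambda>z. frechet_derivative \<phi> (at z) v)" for v
    using Ck_lincomb[OF assms(2,3)] by presburger
  moreover have "\<phi> differentiable (at z)" for z
    using has_partialsD[OF assms(1)] by (rule differentiableI)
  ultimately show ?thesis by simp
qed

lemma Ck_SucE:
  fixes \<phi> :: "real \<times> real \<Rightarrow> real"
  assumes "Ck (Suc k) \<phi>"
  obtains p q where "has_partials \<phi> p q" "Ck k p" "Ck k q"
proof
  let ?D = "\<lambda>z. frechet_derivative \<phi> (at z)"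
  show "Ck k (\<lambda>z. ?D z (1, 0))" "Ck k (\<lambda>z. ?D z (0, 1))"
    using assms by simp_all
  show "has_partials \<phi> (\<lambda>z. ?D z (1, 0)) (\<lambda>z. ?D z (0, 1))"
    unfolding has_partials_def
  proof
    fix z
    have D: "(\<phi> has_derivative ?D z) (at z)"
      using assms unfolding Ck_on.simps frechet_derivative_works by blast
    then interpret linear "?D z" by (rule has_derivative_linear)
    have eq: "fst v * ?D z (1, 0) + snd v * ?D z (0, 1) = ?D z v" for v
    proof -
      have "fst v *\<^sub>R (1, 0) + snd v *\<^sub>R (0, 1) = v" by (simp add: prod_eq_iff)
      moreover have "?D z (fst v *\<^sub>R (1, 0) + snd v *\<^sub>R (0, 1)) =
          fst v * ?D z (1, 0) + snd v * ?D z (0, 1)"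
        unfolding add scale by simp
      ultimately show ?thesis by simp
    qed
    show "(\<phi> has_derivative (\<lambda>v. fst v * ?D z (1, 0) + snd v * ?D z (0, 1))) (at z)"
      unfolding eq by (rule D)
  qed
qed

lemma Ck_Suc_imp_Ck:
  fixes \<phi> :: "real \<times> real \<Rightarrow> real"
  assumes "Ck (Suc k) \<phi>" shows "Ck k \<phi>"
  using assms
proof (induction k arbitrary: \<phi>)
  case 0
  then show ?case
    by (auto intro!: continuous_at_imp_continuous_on differentiable_imp_continuous_within)
next
  case (Suc k)
  from Suc.prems obtain p q where "has_partials \<phi> p q" "Ck (Suc k) p" "Ck (Suc k) q"
    by (rule Ck_SucE)
  then show ?case by (intro Ck_SucI[of \<phi> p q] Suc.IH)
qed

lemma Ck_mono:
  fixes \<phi> :: "real \<times> real \<Rightarrow> real"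
  assumes "Ck k \<phi>" "j \<le> k" shows "Ck j \<phi>"
  using assms(2,1) by (induction rule: inc_induct) (auto intro: Ck_Suc_imp_Ck simp del: Ck_on.simps)

lemma Ck_continuous:
  fixes \<phi> :: "real \<times> real \<Rightarrow> real"
  shows "Ck k \<phi> \<Longrightarrow> continuous_on UNIV \<phi>"
  using Ck_mono[of k \<phi> 0] by simp

lemma has_partials_continuous: "has_partials \<phi> p q \<Longrightarrow> continuous_on UNIV \<phi>"
  by (meson continuous_at_imp_continuous_on has_derivative_continuous has_partialsD)

lemma has_partials_unique_x:
  assumes "has_partials \<phi> p q" "\<And>x r. ((\<lambda>x. \<phi> (x, r)) has_real_derivative p' (x, r)) (at x)"
  shows "p = p'"
  using DERIV_unique[OF has_partials_x[OF assms(1)] assms(2)] by auto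

lemma Ck_const: "Ck k (\<lambda>z. c :: real)"
  by (induction k arbitrary: c) simp_all

lemma has_partials_const: "has_partials (\<lambda>z. c) (\<lambda>z. 0) (\<lambda>z. 0)"
  by (simp add: has_partials_def)

lemma has_partials_fst: "has_partials fst (\<lambda>z. 1) (\<lambda>z. 0)"
  by (auto simp: has_partials_def intro!: derivative_eq_intros)

lemma has_partials_snd: "has_partials snd (\<lambda>z. 0) (\<lambda>z. 1)"
  by (auto simp: has_partials_def intro!: derivative_eq_intros)

lemma Ck_fst: "Ck k (fst :: real \<times> real \<Rightarrow> real)"
proof (cases k)
  case 0
  then show ?thesis by (simp add: continuous_on_fst continuous_on_id)
next
  case (Suc j)
  then show ?thesis by (simp only:) (rule Ck_SucI[OF has_partials_fst]; rule Ck_const)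
qed

lemma Ck_snd: "Ck k (snd :: real \<times> real \<Rightarrow> real)"
proof (cases k)
  case 0
  then show ?thesis by (simp add: continuous_on_snd continuous_on_id)
next
  case (Suc j)
  then show ?thesis by (simp only:) (rule Ck_SucI[OF has_partials_snd]; rule Ck_const)
qed

lemma Ck_add:
  fixes p q :: "real \<times> real \<Rightarrow> real"
  shows "Ck k p \<Longrightarrow> Ck k q \<Longrightarrow> Ck k (\<lambda>z. p z + q z)"
  using Ck_lincomb[of k p q 1 1] by simp

lemma Ck_diff:
  fixes p q :: "real \<times> real \<Rightarrow> real"
  shows "Ck k p \<Longrightarrow> Ck k q \<Longrightarrow> Ck k (\<lambda>z. p z - q z)"
  using Ck_lincomb[of k p q 1 "-1"] by simp

lemma Ck_mult:
  fixes p q :: "real \<times> real \<Rightarrow> real"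
  assumes "Ck k p" "Ck k q"
  shows "Ck k (\<lambda>z. p z * q z)"
  using assms
proof (induction k arbitrary: p q)
  case 0
  then show ?case by (auto intro: continuous_intros)
next
  case (Suc k)
  obtain a b where p: "has_partials p a b" "Ck k a" "Ck k b"
    using Suc.prems(1) by (rule Ck_SucE)
  obtain c d where q: "has_partials q c d" "Ck k c" "Ck k d"
    using Suc.prems(2) by (rule Ck_SucE)
  have "has_partials (\<lambda>z. p z * q z) (\<lambda>z. a z * q z + p z * c z) (\<lambda>z. b z * q z + p z * d z)"
    unfolding has_partials_def
    by (auto intro!: derivative_eq_intros has_partialsD[OF p(1)] has_partialsD[OF q(1)]
        simp: algebra_simps)
  then show ?case
    by (rule Ck_SucI) (intro Ck_add Suc.IH p q Suc.prems[THEN Ck_Suc_imp_Ck])+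
qed

lemma has_partials_compose:
  assumes "has_partials \<phi> p q" "has_partials \<alpha> a b" "has_partials \<beta> c d"
  shows "has_partials (\<lambda>z. \<phi> (\<alpha> z, \<beta> z))
    (\<lambda>z. a z * p (\<alpha> z, \<beta> z) + c z * q (\<alpha> z, \<beta> z))
    (\<lambda>z. b z * p (\<alpha> z, \<beta> z) + d z * q (\<alpha> z, \<beta> z))"
  unfolding has_partials_def
proof
  fix z
  have "((\<lambda>z. (\<alpha> z, \<beta> z)) has_derivative
      (\<lambda>v. (fst v * a z + snd v * b z, fst v * c z + snd v * d z))) (at z)"
    by (intro has_derivative_Pair has_partialsD assms)
  from has_derivative_compose[OF this has_partialsD[OF assms(1)]]
  show "((\<lambda>z. \<phi> (\<alpha> z, \<beta> z)) has_derivative (\<lambda>v.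
      fst v * (a z * p (\<alpha> z, \<beta> z) + c z * q (\<alpha> z, \<beta> z)) +
      snd v * (b z * p (\<alpha> z, \<beta> z) + d z * q (\<alpha> z, \<beta> z)))) (at z)"
    by (simp add: algebra_simps)
qed

lemma Ck_compose:
  fixes \<phi> :: "real \<times> real \<Rightarrow> real"
  assumes "Ck k \<phi>" "Ck k \<alpha>" "Ck k \<beta>"
  shows "Ck k (\<lambda>z. \<phi> (\<alpha> z, \<beta> z))"
  using assms
proof (induction k arbitrary: \<phi> \<alpha> \<beta>)
  case 0
  then show ?case
    by (auto intro!: continuous_on_compose2[of UNIV \<phi>] continuous_on_Pair)
next
  case (Suc k)
  obtain p q where 1: "has_partials \<phi> p q" "Ck k p" "Ck k q"
    using Suc.prems(1) by (rule Ck_SucE)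
  obtain a b where 2: "has_partials \<alpha> a b" "Ck k a" "Ck k b"
    using Suc.prems(2) by (rule Ck_SucE)
  obtain c d where 3: "has_partials \<beta> c d" "Ck k c" "Ck k d"
    using Suc.prems(3) by (rule Ck_SucE)
  note sub = Suc.prems(2,3)[THEN Ck_Suc_imp_Ck]
  show ?case
    by (rule Ck_SucI[OF has_partials_compose[OF 1(1) 2(1) 3(1)]])
      (intro Ck_add Ck_mult Suc.IH 1 2 3 sub)+
qed

lemma Ck_inverse:
  fixes \<phi> :: "real \<times> real \<Rightarrow> real"
  assumes "Ck k \<phi>" "\<And>z. \<phi> z \<noteq> 0"
  shows "Ck k (\<lambda>z. inverse (\<phi> z))"
  using assms(1)
proof (induction k)
  case 0
  then show ?case using assms(2) by (auto intro: continuous_on_inverse)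
next
  case (Suc k)
  obtain p q where \<phi>: "has_partials \<phi> p q" "Ck k p" "Ck k q"
    using Suc.prems(1) by (rule Ck_SucE)
  define i where "i = (\<lambda>z. inverse (\<phi> z))"
  have i: "Ck k i"
    using Suc unfolding i_def by (blast intro: Ck_Suc_imp_Ck)
  have "has_partials i (\<lambda>z. 0 - i z * p z * i z) (\<lambda>z. 0 - i z * q z * i z)"
    unfolding has_partials_def i_def using assms(2)
    by (auto intro!: derivative_eq_intros has_partialsD[OF \<phi>(1)] simp: algebra_simps)
  then have "Ck (Suc k) i"
    by (rule Ck_SucI) (intro Ck_diff Ck_mult Ck_const \<phi> i)+
  then show ?case by (simp add: i_def)
qed

section \<open>Inverses along the first coordinate\<close>

text \<open>
  Inverses of increasing functions depend continuously on the function, already under pointwise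
  convergence: if \<open>a < x\<^sub>0 < b\<close>, then the values at \<open>a\<close> and \<open>b\<close> eventually enclose the value taken at
  \<open>hs \<xi>\<close>. With a filter of points this is the continuity of a fibrewise inverse; with a filter
  of pairs of an index and a point it is the convergence of the approximating maps.
\<close>
lemma tendsto_of_strict_mono_tendsto:
  fixes g\<^sub>0 :: "real \<Rightarrow> real" and gs :: "'a \<Rightarrow> real \<Rightarrow> real"
  assumes mono: "strict_mono g\<^sub>0" "\<And>\<xi>. strict_mono (gs \<xi>)"
    and gs: "\<And>x. ((\<lambda>\<xi>. gs \<xi> x) \<longlongrightarrow> g\<^sub>0 x) F"
    and hs: "((\<lambda>\<xi>. gs \<xi> (hs \<xi>)) \<longlongrightarrow> g\<^sub>0 x\<^sub>0) F"
  shows "(hs \<longlongrightarrow> x\<^sub>0) F"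
proof (rule order_tendstoI)
  fix a assume "a < x\<^sub>0"
  then obtain m where "g\<^sub>0 a < m" "m < g\<^sub>0 x\<^sub>0"
    using dense[of "g\<^sub>0 a" "g\<^sub>0 x\<^sub>0"] strict_mono_less[OF mono(1)] by blast
  then have "\<forall>\<^sub>F \<xi> in F. gs \<xi> a < m" "\<forall>\<^sub>F \<xi> in F. m < gs \<xi> (hs \<xi>)"
    using order_tendstoD[OF gs[of a]] order_tendstoD[OF hs] by auto
  then show "\<forall>\<^sub>F \<xi> in F. a < hs \<xi>"
    by eventually_elim (use strict_mono_less[OF mono(2)] order_less_trans in blast)
next
  fix a assume "x\<^sub>0 < a"
  then obtain m where "g\<^sub>0 x\<^sub>0 < m" "m < g\<^sub>0 a"
    using dense[of "g\<^sub>0 x\<^sub>0" "g\<^sub>0 a"] strict_mono_less[OF mono(1)] by blast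
  then have "\<forall>\<^sub>F \<xi> in F. m < gs \<xi> a" "\<forall>\<^sub>F \<xi> in F. gs \<xi> (hs \<xi>) < m"
    using order_tendstoD[OF gs[of a]] order_tendstoD[OF hs] by auto
  then show "\<forall>\<^sub>F \<xi> in F. hs \<xi> < a"
    by eventually_elim (use strict_mono_less[OF mono(2)] order_less_trans in blast)
qed

lemma strict_mono_if_deriv_pos:
  fixes f :: "real \<Rightarrow> real"
  assumes "\<And>x. (f has_real_derivative f' x) (at x)" "\<And>x. f' x > 0"
  shows "strict_mono f"
proof (rule strict_monoI)
  fix x y :: real assume "x < y"
  then show "f x < f y"
    by (rule DERIV_pos_imp_increasing) (use assms in blast)
qed

text \<open>
  The derivative of the inverse of \<open>(x, r) \<mapsto> (g(x, r), r)\<close>, read off from the inverse of a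
  triangular matrix.
\<close>
lemma has_partials_fibred_inverse:
  assumes g: "has_partials g p q" and p: "\<And>z. p z \<noteq> 0" and h: "continuous_on UNIV h"
    and gh: "\<And>z. g (h z, snd z) = fst z"
  shows "has_partials h (\<lambda>z. inverse (p (h z, snd z)))
    (\<lambda>z. 0 - q (h z, snd z) * inverse (p (h z, snd z)))"
  unfolding has_partials_def
proof
  fix z :: "real \<times> real"
  define y where "y = (h z, snd z)"
  define L where "L = (\<lambda>v::real \<times> real. (fst v * p y + snd v * q y, snd v))"
  define M where "M = (\<lambda>v::real \<times> real.
    (fst v * inverse (p y) + snd v * (0 - q y * inverse (p y)), snd v))"
  have M: "bounded_linear M" unfolding M_def
    by (intro bounded_linear_intros)
  have "((\<lambda>z. (h z, snd z)) has_derivative M) (at z)"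
  proof (rule has_derivative_inverse_basic[where f = "\<lambda>u. (g u, snd u)" and f' = L and T = UNIV])
    show "((\<lambda>u. (g u, snd u)) has_derivative L) (at (h z, snd z))"
      unfolding L_def y_def
      by (intro has_derivative_Pair has_partialsD[OF g] has_derivative_snd has_derivative_ident)
    show "M \<circ> L = id" using p[of y] by (auto simp: M_def L_def fun_eq_iff field_simps)
    show "continuous (at z) (\<lambda>z. (h z, snd z))"
      by (intro continuous_intros) (use h continuous_on_eq_continuous_at[OF open_UNIV] in blast)
    show "(g (h u, snd u), snd (h u, snd u)) = u" for u by (simp add: gh)
  qed (use M in auto)
  from has_derivative_fst[OF this]
  show "(h has_derivative (\<lambda>v. fst v * inverse (p (h z, snd z)) +
      snd v * (0 - q (h z, snd z) * inverse (p (h z, snd z))))) (at z)"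
    by (simp add: M_def y_def)
qed

text \<open>
  Bootstrapping: the partial derivatives of \<open>h\<close> are rational expressions in the partial derivatives
  of \<open>g\<close> composed with \<open>h\<close>, so they are as smooth as \<open>h\<close> is already known to be.
\<close>
lemma Ck_fibred_inverse:
  assumes g: "Ck k g"
    and p: "\<And>x r. ((\<lambda>x. g (x, r)) has_real_derivative p (x, r)) (at x)" "\<And>z. p z > 0"
    and gh: "\<And>z. g (h z, snd z) = fst z"
  shows "Ck k h"
  using g
proof (induction k)
  case 0
  have mono: "strict_mono (\<lambda>x. g (x, r))" for r
    using strict_mono_if_deriv_pos[OF p(1) p(2)] .
  have c: "isCont g z" for z
    using 0 unfolding Ck_on.simps continuous_on_eq_continuous_at[OF open_UNIV] by blast
  have "isCont h z" for z
    unfolding continuous_at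
  proof (rule tendsto_of_strict_mono_tendsto[OF mono mono])
    show "((\<lambda>u. g (x, snd u)) \<longlongrightarrow> g (x, snd z)) (at z)" for x
      by (intro isCont_tendsto_compose[OF c] tendsto_intros)
    show "((\<lambda>u. g (h u, snd u)) \<longlongrightarrow> g (h z, snd z)) (at z)"
      unfolding gh by (intro tendsto_intros)
  qed
  then show ?case unfolding Ck_on.simps continuous_on_eq_continuous_at[OF open_UNIV] by blast
next
  case (Suc k)
  obtain p' q where g: "has_partials g p' q" "Ck k p'" "Ck k q"
    using Suc.prems by (rule Ck_SucE)
  have pp: "p' = p" using has_partials_unique_x[OF g(1) p(1)] .
  have h: "Ck k h" using Suc by (blast intro: Ck_Suc_imp_Ck)
  have nz: "p' z \<noteq> 0" for z using p(2)[of z] by (simp add: pp)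
  note sub = Ck_compose[OF g(2) h Ck_snd] Ck_compose[OF g(3) h Ck_snd]
  show ?case
    by (rule Ck_SucI[OF has_partials_fibred_inverse[OF g(1) nz Ck_continuous[OF h] gh]])
      (intro Ck_diff Ck_const Ck_mult Ck_inverse sub nz)+
qed

section \<open>Primitives and centred difference quotients\<close>

text \<open>
  This is \<open>\<integral>\<^sub>0\<^sup>x q(t, r) dt\<close>, rescaled to a fixed interval: no case distinction on the sign of \<open>x\<close> is
  needed, and continuity in both variables together is that of an integral with a parameter.
\<close>
definition prim_x :: "(real \<times> real \<Rightarrow> real) \<Rightarrow> real \<times> real \<Rightarrow> real"
  where "prim_x q z = fst z * integral {0..1} (\<lambda>t. q (fst z * t, snd z))"

lemma prim_x_0 [simp]: "prim_x q (0, r) = 0"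
  by (simp add: prim_x_def)

lemma continuous_prim_x:
  assumes "continuous_on UNIV q" shows "continuous_on UNIV (prim_x q)"
proof -
  have "continuous_on UNIV (\<lambda>z. integral (cbox 0 1) (\<lambda>t. q (fst z * t, snd z)))"
    by (intro integral_continuous_on_param)
      (auto simp: case_prod_beta' intro!: continuous_on_compose2[OF assms] continuous_intros)
  then show ?thesis unfolding prim_x_def by (intro continuous_intros) simp
qed

lemma prim_x_deriv_x:
  assumes q: "continuous_on UNIV q"
  shows "((\<lambda>x. prim_x q (x, r)) has_real_derivative q (x, r)) (at x)"
proof -
  \<comment> \<open>Near \<open>x\<close> the function is \<open>\<Theta> y - \<Theta> 0\<close> for a primitive \<open>\<Theta>\<close> on a symmetric interval,
    which contains the segment from \<open>0\<close> to \<open>y\<close> whatever the sign of \<open>y\<close>.\<close>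
  define N where "N = \<bar>x\<bar> + 1"
  have "continuous_on {-N..N} (\<lambda>x. q (x, r))"
    by (intro continuous_on_compose2[OF q] continuous_intros) auto
  then obtain \<Theta> where \<Theta>: "\<And>y. y \<in> {-N..N} \<Longrightarrow>
      (\<Theta> has_vector_derivative q (y, r)) (at y within {-N..N})"
    using antiderivative_continuous by blast
  have eq: "\<Theta> y - \<Theta> 0 = prim_x q (y, r)" if y: "y \<in> {-N<..<N}" for y
  proof -
    have in_N: "y * t \<in> {-N..N}" if "t \<in> {0..1}" for t
    proof -
      have "\<bar>y * t\<bar> \<le> \<bar>y\<bar>" using that by (simp add: abs_mult mult_left_le)
      then show ?thesis using y by (auto simp: abs_le_iff)
    qed
    have "((\<lambda>t. \<Theta> (y * t)) has_vector_derivative y * q (y * t, r)) (at t within {0..1})"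
      if t: "t \<in> {0..1}" for t
    proof -
      have "((\<lambda>t. y * t) has_vector_derivative y) (at t within {0..1})"
        by (auto intro!: derivative_eq_intros)
      moreover have "(\<Theta> has_vector_derivative q (y * t, r)) (at (y * t) within (\<lambda>t. y * t) ` {0..1})"
        using \<Theta>[OF in_N[OF t]] in_N by (rule_tac has_vector_derivative_within_subset) auto
      ultimately show ?thesis
        using vector_diff_chain_within[of "\<lambda>t. y * t" y t "{0..1}" \<Theta>] by (simp add: o_def)
    qed
    from fundamental_theorem_of_calculus[OF _ this]
    have "((\<lambda>t. y * q (y * t, r)) has_integral \<Theta> (y * 1) - \<Theta> (y * 0)) {0..1}"
      by simp
    then show ?thesis by (auto simp: prim_x_def dest!: integral_unique)
  qed
  have x: "x \<in> {-N<..<N}" by (auto simp: N_def)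
  have "(\<Theta> has_vector_derivative q (x, r)) (at x)"
    using \<Theta>[of x] x at_within_interior[of x "{-N..N}"] by (auto simp: interior_atLeastAtMost_real)
  then have "((\<lambda>y. \<Theta> y - \<Theta> 0) has_real_derivative q (x, r)) (at x)"
    unfolding has_real_derivative_iff_has_vector_derivative
    by (auto intro!: derivative_eq_intros)
  then show ?thesis
    by (rule DERIV_cong_ev[THEN iffD1, OF refl _ refl, rotated])
      (use x eq in \<open>auto intro!: eventually_nhds_in_open[THEN eventually_mono, of "{-N<..<N}"]\<close>)
qed

lemma prim_x_deriv_r:
  assumes q: "has_partials q a b" and b: "continuous_on UNIV b"
  shows "((\<lambda>r. prim_x q (x, r)) has_real_derivative prim_x b (x, r)) (at r)"
proof -
  have "((\<lambda>r. integral (cbox 0 1) (\<lambda>t. q (x * t, r))) has_real_derivative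
      integral (cbox 0 1) (\<lambda>t. b (x * t, r))) (at r within UNIV)"
  proof (rule leibniz_rule_field_derivative)
    show "((\<lambda>r. q (x * t, r)) has_real_derivative b (x * t, r)) (at r within UNIV)" for r t
      using has_partials_r[OF q] by simp
    show "(\<lambda>t. q (x * t, r)) integrable_on cbox 0 1" for r
      by (intro integrable_continuous continuous_on_compose2[OF has_partials_continuous[OF q]]
          continuous_intros) auto
    show "continuous_on (UNIV \<times> cbox 0 1) (\<lambda>(r, t). b (x * t, r))"
      unfolding case_prod_beta' by (intro continuous_on_compose2[OF b] continuous_intros) auto
  qed auto
  then show ?thesis
    unfolding prim_x_def fst_conv snd_conv by (intro DERIV_cmult) simp
qed

lemma has_partials_prim_x:
  assumes "has_partials q a b" "continuous_on UNIV b"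
  shows "has_partials (prim_x q) q (prim_x b)"
  by (intro has_partialsI prim_x_deriv_x prim_x_deriv_r[OF assms] continuous_prim_x
      has_partials_continuous[OF assms(1)] assms(2))

lemma Ck_prim_x: "Ck k q \<Longrightarrow> Ck k (prim_x q)"
proof (induction k arbitrary: q)
  case 0
  then show ?case by (simp add: continuous_prim_x)
next
  case (Suc k)
  obtain a b where q: "has_partials q a b" "Ck k a" "Ck k b"
    using Suc.prems by (rule Ck_SucE)
  show ?case
    by (rule Ck_SucI[OF has_partials_prim_x[OF q(1) Ck_continuous[OF q(3)]]])
      (intro Ck_Suc_imp_Ck[OF Suc.prems] Suc.IH q)+
qed

text \<open>
  The primitive \<open>\<integral>\<^sub>0\<^sup>r q(x, s) ds\<close> in the second variable.
\<close>
definition prim_r :: "(real \<times> real \<Rightarrow> real) \<Rightarrow> real \<times> real \<Rightarrow> real"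
  where "prim_r q = prim_x (q \<circ> prod.swap) \<circ> prod.swap"

lemma has_partials_swap:
  assumes "has_partials \<phi> p q"
  shows "has_partials (\<phi> \<circ> prod.swap) (q \<circ> prod.swap) (p \<circ> prod.swap)"
  using has_partials_compose[OF assms has_partials_snd has_partials_fst]
  by (simp add: prod.swap_def comp_def)

lemma Ck_swap: "Ck k \<phi> \<Longrightarrow> Ck k (\<phi> \<circ> prod.swap)" for \<phi> :: "real \<times> real \<Rightarrow> real"
  using Ck_compose[OF _ Ck_snd Ck_fst] by (simp add: prod.swap_def comp_def)

lemma has_partials_prim_r:
  assumes "has_partials q a b" "continuous_on UNIV a"
  shows "has_partials (prim_r q) (prim_r a) q"
proof -
  have "continuous_on UNIV (a \<circ> prod.swap)"
    using Ck_swap[of 0 a] assms(2) by simp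
  from has_partials_swap[OF has_partials_prim_x[OF has_partials_swap[OF assms(1)] this]]
  show ?thesis by (simp add: prim_r_def comp_assoc)
qed

lemma Ck_prim_r: "Ck k q \<Longrightarrow> Ck k (prim_r q)"
  unfolding prim_r_def by (intro Ck_swap Ck_prim_x)

lemma prim_r_0 [simp]: "prim_r q (x, 0) = 0"
  by (simp add: prim_r_def)

lemma prim_r_deriv_r:
  assumes "continuous_on UNIV q"
  shows "((\<lambda>r. prim_r q (x, r)) has_real_derivative q (x, r)) (at r)"
  using prim_x_deriv_x[of "q \<circ> prod.swap" x r] Ck_swap[of 0 q] assms by (simp add: prim_r_def)

text \<open>
  Applied to \<open>prim_r q\<close> this is the average of \<open>q\<close> over the vertical segment of length \<open>2\<epsilon>\<close>
  centred at \<open>z\<close>. Writing averages as difference quotients makes their derivatives and their limits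
  instances of the same few lemmas.
\<close>
definition centred_dq :: "real \<Rightarrow> (real \<times> real \<Rightarrow> real) \<Rightarrow> real \<times> real \<Rightarrow> real"
  where "centred_dq \<epsilon> q z = (q (fst z, snd z + \<epsilon>) - q (fst z, snd z - \<epsilon>)) / (2 * \<epsilon>)"

lemma has_partials_centred_dq:
  assumes "has_partials q a b" shows "has_partials (centred_dq \<epsilon> q) (centred_dq \<epsilon> a) (centred_dq \<epsilon> b)"
proof -
  have *: "((\<lambda>z. q (fst z, snd z + c)) has_derivative
      (\<lambda>v. fst v * a (fst z, snd z + c) + snd v * b (fst z, snd z + c))) (at z)" for z c
  proof -
    have "((\<lambda>z::real \<times> real. (fst z, snd z + c)) has_derivative (\<lambda>v. v)) (at z)"
      by (auto intro!: derivative_eq_intros)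
    from has_derivative_compose[OF this has_partialsD[OF assms]] show ?thesis .
  qed
  have eq: "(v * a1 + w * b1 - (v * a2 + w * b2)) / c = v * ((a1 - a2) / c) + w * ((b1 - b2) / c)"
    for v w a1 a2 b1 b2 c :: real
    by (cases "c = 0") (simp_all add: field_simps)
  have "(centred_dq \<epsilon> q has_derivative (\<lambda>v. fst v * centred_dq \<epsilon> a z + snd v * centred_dq \<epsilon> b z)) (at z)" for z
    using bounded_linear.has_derivative[OF bounded_linear_divide[of "2 * \<epsilon>"]
        has_derivative_diff[OF *[of \<epsilon> z] *[of "- \<epsilon>" z]]]
    unfolding centred_dq_def eq by (simp only: add_uminus_conv_diff diff_conv_add_uminus[symmetric])
  then show ?thesis unfolding has_partials_def by blast
qed

lemma Ck_centred_dq: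
  assumes "Ck k q" shows "Ck k (centred_dq \<epsilon> q)"
proof -
  have *: "Ck k (\<lambda>z. q (fst z, snd z + c))" for c
    by (intro Ck_compose[OF assms] Ck_fst Ck_add Ck_snd Ck_const)
  have "centred_dq \<epsilon> q = (\<lambda>z. (1 / (2 * \<epsilon>)) * q (fst z, snd z + \<epsilon>) + (- 1 / (2 * \<epsilon>)) * q (fst z, snd z + (- \<epsilon>)))"
    by (auto simp: centred_dq_def fun_eq_iff diff_divide_distrib)
  then show ?thesis using Ck_lincomb[OF *[of \<epsilon>] *[of "- \<epsilon>"]] by presburger
qed

lemma centred_dq_mvt:
  assumes "\<epsilon> > 0" "\<And>x r. ((\<lambda>r. A (x, r)) has_real_derivative B (x, r)) (at r)"
  obtains s where "\<bar>s - snd z\<bar> < \<epsilon>" "centred_dq \<epsilon> A z = B (fst z, s)"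
proof -
  have "snd z - \<epsilon> < snd z + \<epsilon>" using assms(1) by simp
  from MVT2[OF this assms(2)] obtain s where s: "snd z - \<epsilon> < s" "s < snd z + \<epsilon>"
    "A (fst z, snd z + \<epsilon>) - A (fst z, snd z - \<epsilon>) = (2 * \<epsilon>) * B (fst z, s)"
    by auto
  show ?thesis
  proof (rule that)
    show "\<bar>s - snd z\<bar> < \<epsilon>" using s by auto
    show "centred_dq \<epsilon> A z = B (fst z, s)" using s(3) assms(1) by (simp add: centred_dq_def)
  qed
qed

text \<open>
  The quotient is a value of \<open>B\<close> at height within \<open>\<epsilon>\<close>, so the convergence is uniform enough to let
  the base point vary as well.
\<close>
lemma tendsto_centred_dq:
  assumes A: "\<And>x r. ((\<lambda>r. A (x, r)) has_real_derivative B (x, r)) (at r)"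
    and B: "continuous_on UNIV B" and \<epsilon>: "\<And>\<xi>. \<epsilon> \<xi> > 0" "(\<epsilon> \<longlongrightarrow> 0) F"
    and x: "(xs \<longlongrightarrow> x) F" and r: "(rs \<longlongrightarrow> r) F"
  shows "((\<lambda>\<xi>. centred_dq (\<epsilon> \<xi>) A (xs \<xi>, rs \<xi>)) \<longlongrightarrow> B (x, r)) F"
proof -
  have "\<exists>s. \<bar>s - rs \<xi>\<bar> < \<epsilon> \<xi> \<and> centred_dq (\<epsilon> \<xi>) A (xs \<xi>, rs \<xi>) = B (xs \<xi>, s)" for \<xi>
  proof -
    obtain s where "\<bar>s - snd (xs \<xi>, rs \<xi>)\<bar> < \<epsilon> \<xi>"
        "centred_dq (\<epsilon> \<xi>) A (xs \<xi>, rs \<xi>) = B (fst (xs \<xi>, rs \<xi>), s)"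
      by (rule centred_dq_mvt[where A = A and B = B and \<epsilon> = "\<epsilon> \<xi>" and z = "(xs \<xi>, rs \<xi>)"])
        (rule \<epsilon>(1), rule A, rule that)
    then show ?thesis unfolding fst_conv snd_conv by (intro exI conjI)
  qed
  then have "\<forall>\<xi>. \<exists>s. \<bar>s - rs \<xi>\<bar> < \<epsilon> \<xi> \<and> centred_dq (\<epsilon> \<xi>) A (xs \<xi>, rs \<xi>) = B (xs \<xi>, s)"
    by (rule allI)
  from choice[OF this] obtain s where s: "\<And>\<xi>. \<bar>s \<xi> - rs \<xi>\<bar> < \<epsilon> \<xi>"
      "\<And>\<xi>. centred_dq (\<epsilon> \<xi>) A (xs \<xi>, rs \<xi>) = B (xs \<xi>, s \<xi>)" by blast
  have "norm (s \<xi> - rs \<xi>) \<le> \<epsilon> \<xi>" for \<xi>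
    using s(1)[of \<xi>] by simp
  then have "((\<lambda>\<xi>. s \<xi> - rs \<xi>) \<longlongrightarrow> 0) F"
    by (intro Lim_null_comparison[OF _ \<epsilon>(2)] always_eventually allI)
  from tendsto_add[OF this r] have s_lim: "(s \<longlongrightarrow> r) F" by simp
  have "isCont B (x, r)" using B continuous_on_eq_continuous_at[OF open_UNIV] by blast
  from isCont_tendsto_compose[OF this tendsto_Pair[OF x s_lim]] show ?thesis
    unfolding s(2) .
qed

section \<open>Maps of the annulus from maps of the plane\<close>

lemma periodic_int:
  fixes \<phi> :: "real \<Rightarrow> 'b"
  assumes "\<And>x. \<phi> (x + 1) = \<phi> x"
  shows "\<phi> (x + of_int n) = \<phi> x"
proof (induction n arbitrary: x rule: int_induct[where k = 0])
  case base
  then show ?case by simp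
next
  case (step1 i)
  have "\<phi> (x + of_int (i + 1)) = \<phi> (x + of_int i + 1)" by (simp add: add.assoc)
  then show ?case using assms step1 by simp
next
  case (step2 i)
  have "\<phi> (x + of_int (i - 1)) = \<phi> (x + of_int (i - 1) + 1)"
    by (rule assms[symmetric])
  also have "x + of_int (i - 1) + 1 = x + of_int i" by simp
  finally show ?case using step2 by simp
qed

lemma cover_eqE:
  assumes "cover u = cover w"
  obtains n :: int where "u = (fst w + of_int n, snd w)"
proof -
  have "fst u - fst w \<in> \<int>" "snd u = snd w" using assms by (simp_all add: cover_eq_iff)
  then obtain n where "fst u - fst w = of_int n" by (auto elim: Ints_cases)
  then have "u = (fst w + of_int n, snd w)" using \<open>snd u = snd w\<close> by (auto simp: prod_eq_iff)
  then show ?thesis by (rule that)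
qed

definition lift_point :: "annulus \<Rightarrow> real \<times> real"
  where "lift_point z = (rep_circle (fst z), snd z)"

lemma cover_lift_point [simp]: "cover (lift_point z) = z"
  by (simp add: lift_point_def cover_def Quotient_abs_rep[OF Quotient_circle])

lemma periodic_lift_point:
  assumes "\<And>x r. s (x + 1, r) = s (x, r)"
  shows "s (lift_point (cover w)) = s w"
proof -
  obtain n where n: "lift_point (cover w) = (fst w + of_int n, snd w)"
    using cover_eqE[of "lift_point (cover w)" w] by auto
  show ?thesis unfolding n
    using periodic_int[of "\<lambda>x. s (x, snd w)" "fst w" n] assms by simp
qed

text \<open>
  Commutation with the deck transformation \<open>(x, r) \<mapsto> (x + 1, r)\<close>: the continuous ones among these
  maps are the lifts of the continuous maps of the annulus homotopic to the identity.
\<close>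
definition equivariant :: "(real \<times> real \<Rightarrow> real \<times> real) \<Rightarrow> bool"
  where "equivariant F \<longleftrightarrow> (\<forall>x r. F (x + 1, r) = (fst (F (x, r)) + 1, snd (F (x, r))))"

definition descend :: "(real \<times> real \<Rightarrow> real \<times> real) \<Rightarrow> annulus \<Rightarrow> annulus"
  where "descend F z = cover (F (lift_point z))"

lemma descend_cover:
  assumes "equivariant F" shows "descend F (cover w) = cover (F w)"
proof -
  have "cover (F (x + 1, r)) = cover (F (x, r))" for x r
    using assms by (auto simp: equivariant_def cover_eq_iff)
  from periodic_lift_point[of "\<lambda>w. cover (F w)", OF this] show ?thesis
    by (simp add: descend_def)
qed

lemma Ck_map_descend: "equivariant F \<Longrightarrow> Ck k F \<Longrightarrow> Ck_map k (descend F)"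
  unfolding Ck_map_def using descend_cover by blast

lemma continuous_descend:
  "equivariant F \<Longrightarrow> continuous_on UNIV F \<Longrightarrow> continuous_on UNIV (descend F)"
  using Ck_map_descend[of F 0] by (simp add: Ck_map_0_iff)

lemma Ck_diffeo_descend:
  assumes "equivariant F" "equivariant G" "Ck k F" "Ck k G"
    and FG: "\<And>w. F (G w) = w" and GF: "\<And>w. G (F w) = w"
  shows "Ck_diffeo k (descend F)"
proof -
  have 1: "descend F (descend G z) = z" "descend G (descend F z) = z" for z
  proof -
    obtain w where w: "z = cover w" using surj_cover by metis
    show "descend F (descend G z) = z" "descend G (descend F z) = z"
      by (simp_all add: w descend_cover assms)
  qed
  have "inv (descend F) = descend G"
    by (rule inv_equality) (use 1 in auto)
  moreover have "bij (descend F)"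
    by (rule o_bij[of "descend G"]) (use 1 in \<open>auto simp: fun_eq_iff\<close>)
  ultimately show ?thesis
    unfolding Ck_diffeo_def using Ck_map_descend assms(1-4) by simp
qed

text \<open>
  The hypothesis on \<open>s\<close> says that \<open>ds\<close> is the lift of \<open>\<Phi>\<^sup>*(r d\<theta>) - r d\<theta>\<close> for \<open>\<Phi> = descend F\<close>;
  periodicity is what makes \<open>s\<close> a function on the annulus.
\<close>
lemma exact_symplectic_descend:
  assumes F: "equivariant F" and D: "\<And>w. (F has_derivative D w) (at w)"
    and s: "\<And>w. (s has_derivative (\<lambda>v. snd (F w) * fst (D w v) - snd w * fst v)) (at w)"
    and per: "\<And>x r. s (x + 1, r) = s (x, r)"
  shows "exact_symplectic (descend F)"
  unfolding exact_symplectic_def exact_form_def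
proof (intro exI allI)
  fix w
  have "has_annulus_derivative (descend F) (D w) (cover w)"
    unfolding has_annulus_derivative_def
    by (intro exI[of _ w] exI[of _ F] conjI D refl always_eventually allI descend_cover F)
  then have "annulus_derivative (descend F) (cover w) = D w"
    by (rule annulus_derivative_eq)
  moreover have "liouville (cover u) v = snd u * fst v" for u v
    by (simp add: liouville_def cover_def case_prod_beta)
  ultimately have eq: "(\<lambda>v. pullback (descend F) liouville (cover w) v - liouville (cover w) v) =
      (\<lambda>v. snd (F w) * fst (D w v) - snd w * fst v)"
    by (simp add: pullback_def descend_cover[OF F])
  show "((\<lambda>u. (s \<circ> lift_point) (cover u)) has_derivative
      (\<lambda>v. pullback (descend F) liouville (cover w) v - liouville (cover w) v)) (at w)"
    unfolding eq using s by (simp add: periodic_lift_point[OF per])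
qed

text \<open>
  Continuous convergence implies convergence in the compact-open topology. A compact set is covered
  by finitely many of the neighbourhoods \<open>N\<close>; this works without a metric on the spaces, and for a
  family along any filter.
\<close>
lemma limitin_compact_open_topology:
  fixes \<phi> :: "'a::topological_space \<Rightarrow> 'b::topological_space"
  assumes cont: "continuous_on UNIV \<phi>" "\<And>n. continuous_on UNIV (\<psi> n)"
    and loc: "\<And>z U. open U \<Longrightarrow> \<phi> z \<in> U \<Longrightarrow>
      \<exists>N. open N \<and> z \<in> N \<and> (\<forall>\<^sub>F n in A. \<forall>z'\<in>N. \<psi> n z' \<in> U)"
  shows "limitin compact_open_topology \<psi> \<phi> A"
  unfolding limitin_def
proof (intro conjI allI impI)
  show "\<phi> \<in> topspace compact_open_topology"
    unfolding compact_open_topology_def topology_generated_by_topspace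
    using cont(1) by (intro UnionI[of "{f. continuous_on UNIV f \<and> f ` {} \<subseteq> UNIV}"]) blast+
  fix W assume W: "openin compact_open_topology W \<and> \<phi> \<in> W"
  then have "generate_topology_on
      {{f :: 'a \<Rightarrow> 'b. continuous_on UNIV f \<and> f ` K \<subseteq> U} | K U. compact K \<and> open U} W"
    by (simp add: compact_open_topology_def openin_topology_generated_by_iff)
  then have "\<phi> \<in> W \<longrightarrow> (\<forall>\<^sub>F n in A. \<psi> n \<in> W)"
  proof induction
    case Empty
    then show ?case by simp
  next
    case (Int a b)
    then show ?case by (auto intro: eventually_conj)
  next
    case (UN K)
    show ?case
    proof
      assume "\<phi> \<in> \<Union> K"
      then obtain k where "k \<in> K" "\<phi> \<in> k" by blast
      then have "\<forall>\<^sub>F n in A. \<psi> n \<in> k" using UN.IH by simp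
      then show "\<forall>\<^sub>F n in A. \<psi> n \<in> \<Union> K"
        by (rule eventually_mono) (use \<open>k \<in> K\<close> in blast)
    qed
  next
    case (Basis s)
    then obtain K U where s: "s = {f. continuous_on UNIV f \<and> f ` K \<subseteq> U}" "compact K" "open U"
      by blast
    show ?case
    proof
      assume "\<phi> \<in> s"
      then have "\<forall>z\<in>K. \<exists>N. open N \<and> z \<in> N \<and> (\<forall>\<^sub>F n in A. \<forall>z'\<in>N. \<psi> n z' \<in> U)"
        using loc[OF s(3)] by (auto simp: s(1))
      from bchoice[OF this] obtain N where N: "\<And>z. z \<in> K \<Longrightarrow> open (N z)" "\<And>z. z \<in> K \<Longrightarrow> z \<in> N z"
        "\<And>z. z \<in> K \<Longrightarrow> \<forall>\<^sub>F n in A. \<forall>z'\<in>N z. \<psi> n z' \<in> U" by blast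
      obtain C where C: "C \<subseteq> K" "finite C" "K \<subseteq> (\<Union>z\<in>C. N z)"
        by (rule compactE_image[OF s(2), of K N]) (use N in auto)
      have "\<forall>\<^sub>F n in A. \<forall>z\<in>C. \<forall>z'\<in>N z. \<psi> n z' \<in> U"
        using C N(3) by (intro eventually_ball_finite) auto
      then show "\<forall>\<^sub>F n in A. \<psi> n \<in> s"
        by (rule eventually_mono) (use C(3) cont(2) in \<open>unfold s(1), blast\<close>)
    qed
  qed
  with W show "\<forall>\<^sub>F n in A. \<psi> n \<in> W" by simp
qed

text \<open>
  Continuous convergence passes from the plane to the annulus because the covering map is open, so
  the compact subsets of the annulus need not be lifted.
\<close>
lemma limitin_compact_open_descend:
  assumes F: "equivariant F" "continuous_on UNIV F"
    and Fs: "\<And>n. equivariant (Fs n)" "\<And>n. continuous_on UNIV (Fs n)"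
    and lim: "\<And>w. ((\<lambda>(n, u). Fs n u) \<longlongrightarrow> F w) (A \<times>\<^sub>F nhds w)"
  shows "limitin compact_open_topology (\<lambda>n. descend (Fs n)) (descend F) A"
proof (rule limitin_compact_open_topology)
  fix z and U :: "annulus set" assume U: "open U" "descend F z \<in> U"
  obtain w where w: "z = cover w" using surj_cover by metis
  have "open (cover -` U)" using U(1) continuous_cover by (rule open_vimage)
  moreover have "F w \<in> cover -` U" using U(2) by (simp add: w descend_cover[OF F(1)])
  ultimately have "\<forall>\<^sub>F nu in A \<times>\<^sub>F nhds w. (\<lambda>(n, u). Fs n u) nu \<in> cover -` U"
    by (rule topological_tendstoD[OF lim])
  then obtain P Q where P: "eventually P A" and Q: "eventually Q (nhds w)"
    and PQ: "\<And>n u. P n \<Longrightarrow> Q u \<Longrightarrow> Fs n u \<in> cover -` U"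
    by (auto simp: eventually_prod_filter)
  obtain V where V: "open V" "w \<in> V" "\<And>u. u \<in> V \<Longrightarrow> Q u"
    using Q by (auto simp: eventually_nhds)
  show "\<exists>N. open N \<and> z \<in> N \<and> (\<forall>\<^sub>F n in A. \<forall>z'\<in>N. descend (Fs n) z' \<in> U)"
  proof (intro exI conjI)
    show "open (cover ` V)" using V(1) by (rule open_cover_image)
    show "z \<in> cover ` V" using V(2) w by blast
    show "\<forall>\<^sub>F n in A. \<forall>z'\<in>cover ` V. descend (Fs n) z' \<in> U"
      using P by (rule eventually_mono) (use PQ V(3) in \<open>auto simp: descend_cover[OF Fs(1)]\<close>)
  qed
qed (intro continuous_descend F Fs)+

section \<open>Maps with a generating function\<close>

definition fibre_inverse :: "(real \<times> real \<Rightarrow> real) \<Rightarrow> real \<times> real \<Rightarrow> real"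
  where "fibre_inverse g z = (THE x. g (x, snd z) = fst z)"

lemma fibre_inverse_eqI:
  assumes "strict_mono (\<lambda>x. g (x, snd z))" "g (x, snd z) = fst z"
  shows "fibre_inverse g z = x"
  unfolding fibre_inverse_def
proof (rule the_equality)
  show "y = x" if "g (y, snd z) = fst z" for y
    using strict_mono_eq[OF assms(1), of y x] that assms(2) by simp
qed (rule assms(2))

lemma fibre_inverse:
  assumes "strict_mono (\<lambda>x. g (x, snd z))" "\<exists>x. g (x, snd z) = fst z"
  shows "g (fibre_inverse g z, snd z) = fst z"
  using assms(2) fibre_inverse_eqI[OF assms(1)] by auto

text \<open>
  The map \<open>(g(x, r), r) \<mapsto> (x, \<eta>(x, r))\<close>.
\<close>
definition twist :: "(real \<times> real \<Rightarrow> real) \<Rightarrow> (real \<times> real \<Rightarrow> real) \<Rightarrow> real \<times> real \<Rightarrow> real \<times> real"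
  where "twist g \<eta> z = (fibre_inverse g z, \<eta> (fibre_inverse g z, snd z))"

text \<open>
  Here \<open>q\<close> is the mixed second derivative of \<open>U\<close>. It is listed separately because for a \<open>C\<^sup>1\<close>
  foliation \<open>U\<close> need not be twice differentiable: \<open>g\<close> need not have a derivative in \<open>r\<close>.
  Positivity of \<open>q\<close> makes \<open>g\<close> invertible in \<open>x\<close> and \<open>\<eta>\<close> invertible in \<open>r\<close>.
\<close>
locale generating_function =
  fixes U \<eta> g q :: "real \<times> real \<Rightarrow> real"
  assumes U: "has_partials U \<eta> g"
    and quasi_periodic: "U (x + 1, r) = U (x, r) + r"
    and g_x: "((\<lambda>x. g (x, r)) has_real_derivative q (x, r)) (at x)"
    and \<eta>_r: "((\<lambda>r. \<eta> (x, r)) has_real_derivative q (x, r)) (at r)"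
    and q_pos: "q z > 0"
    and cont_\<eta>: "continuous_on UNIV \<eta>" and cont_g: "continuous_on UNIV g"
    and surj_\<eta>: "\<exists>r. \<eta> (x, r) = y"
begin

lemma periodic_\<eta>: "\<eta> (x + 1, r) = \<eta> (x, r)"
proof -
  have "((\<lambda>x. U (x + 1, r)) has_real_derivative \<eta> (x + 1, r)) (at x)"
    using has_partials_x[OF U, of r "x + 1"] by (simp add: DERIV_shift)
  moreover have "((\<lambda>x. U (x + 1, r)) has_real_derivative \<eta> (x, r)) (at x)"
    unfolding quasi_periodic using has_partials_x[OF U, of r x]
    by (auto intro!: derivative_eq_intros)
  ultimately show ?thesis by (rule DERIV_unique)
qed

lemma quasi_periodic_g: "g (x + 1, r) = g (x, r) + 1"
proof -
  have "((\<lambda>r. U (x + 1, r)) has_real_derivative g (x + 1, r)) (at r)"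
    by (rule has_partials_r[OF U])
  moreover have "((\<lambda>r. U (x + 1, r)) has_real_derivative g (x, r) + 1) (at r)"
    unfolding quasi_periodic using has_partials_r[OF U, of x r]
    by (auto intro!: derivative_eq_intros)
  ultimately show ?thesis by (rule DERIV_unique)
qed

lemma mono_g: "strict_mono (\<lambda>x. g (x, r))"
  by (rule strict_mono_if_deriv_pos[OF g_x q_pos])

lemma mono_\<eta>: "strict_mono (\<lambda>r. \<eta> (x, r))"
  by (rule strict_mono_if_deriv_pos[OF \<eta>_r q_pos])

text \<open>
  A continuous function that grows by 1 over each period takes all values.
\<close>
lemma surj_g: "\<exists>x. g (x, r) = y"
proof -
  have g_int: "g (of_int n, r) = g (0, r) + of_int n" for n
    using periodic_int[of "\<lambda>x. g (x, r) - x" 0 n] quasi_periodic_g by simp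
  define n where "n = \<lfloor>y - g (0, r)\<rfloor>"
  have "g (of_int n, r) \<le> y" "y \<le> g (of_int (n + 1), r)"
    unfolding g_int n_def by linarith+
  moreover have "continuous_on {of_int n..of_int (n + 1)} (\<lambda>x. g (x, r))"
    by (intro continuous_on_compose2[OF cont_g] continuous_intros) auto
  ultimately show ?thesis
    using IVT'[of "\<lambda>x. g (x, r)" "of_int n" y "of_int (n + 1)"] by auto
qed

abbreviation h :: "real \<times> real \<Rightarrow> real" where "h \<equiv> fibre_inverse g"

text \<open>
  The mean height of the leaf through a point, i.e. the inverse of \<open>\<eta>\<close> in its second variable.
\<close>
definition R :: "real \<times> real \<Rightarrow> real"
  where "R = fibre_inverse (\<eta> \<circ> prod.swap) \<circ> prod.swap"

lemma g_h: "g (h z, snd z) = fst z"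
  by (rule fibre_inverse[OF mono_g surj_g])

lemma h_eqI: "g (x, r) = y \<Longrightarrow> h (y, r) = x"
  using fibre_inverse_eqI[of g "(y, r)" x] mono_g by simp

lemma \<eta>_R: "\<eta> (fst z, R z) = snd z"
  using fibre_inverse[of "\<eta> \<circ> prod.swap" "prod.swap z"] mono_\<eta> surj_\<eta> by (simp add: R_def)

lemma R_eqI: "\<eta> (x, r) = y \<Longrightarrow> R (x, y) = r"
  using fibre_inverse_eqI[of "\<eta> \<circ> prod.swap" "(y, x)" r] mono_\<eta> by (simp add: R_def)

lemma Ck_h: "Ck k g \<Longrightarrow> Ck k h"
  by (rule Ck_fibred_inverse[OF _ g_x q_pos g_h])

lemma Ck_R:
  assumes "Ck k \<eta>" shows "Ck k R"
  unfolding R_def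
proof (rule Ck_swap, rule Ck_fibred_inverse[where g = "\<eta> \<circ> prod.swap" and p = "q \<circ> prod.swap"])
  show "(\<eta> \<circ> prod.swap) (fibre_inverse (\<eta> \<circ> prod.swap) z, snd z) = fst z" for z
    using \<eta>_R[of "prod.swap z"] by (simp add: R_def)
qed (use Ck_swap[OF assms] \<eta>_r q_pos in simp_all)

lemma equivariant_twist: "equivariant (twist g \<eta>)"
proof -
  have "h (y + 1, r) = h (y, r) + 1" for y r
    using g_h[of "(y, r)"] by (intro h_eqI) (simp add: quasi_periodic_g)
  then show ?thesis by (simp add: equivariant_def twist_def periodic_\<eta>)
qed

lemma Ck_twist: "Ck k g \<Longrightarrow> Ck k \<eta> \<Longrightarrow> Ck k (twist g \<eta>)"
  unfolding twist_def by (intro Ck_on_Pair open_UNIV Ck_compose Ck_h Ck_snd)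

text \<open>
  The inverse map is \<open>(x, y) \<mapsto> (g(x, r), r)\<close> with \<open>r = R(x, y)\<close>, which is as smooth as \<open>g\<close> and \<open>\<eta>\<close>.
\<close>
lemma Ck_diffeo_twist:
  assumes "Ck k g" "Ck k \<eta>" shows "Ck_diffeo k (descend (twist g \<eta>))"
proof (rule Ck_diffeo_descend[where G = "\<lambda>z. (g (fst z, R z), R z)"])
  have "R (x + 1, y) = R (x, y)" for x y
    using \<eta>_R[of "(x, y)"] by (intro R_eqI) (simp add: periodic_\<eta>)
  then show "equivariant (\<lambda>z. (g (fst z, R z), R z))"
    by (simp add: equivariant_def quasi_periodic_g)
  show "Ck k (\<lambda>z. (g (fst z, R z), R z))"
    by (intro Ck_on_Pair open_UNIV Ck_compose Ck_R Ck_fst assms)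
  show "twist g \<eta> (g (fst w, R w), R w) = w" for w
    using \<eta>_R[of w] by (simp add: twist_def h_eqI prod_eq_iff)
  show "(g (fst (twist g \<eta> w), R (twist g \<eta> w)), R (twist g \<eta> w)) = w" for w
    using g_h[of w] by (simp add: twist_def R_eqI prod_eq_iff)
qed (intro equivariant_twist Ck_twist assms)+

text \<open>
  The primitive is \<open>U - r g\<close> in the coordinates \<open>(x, r)\<close>; as \<open>g(h(y, r), r) = y\<close>, it reads
  \<open>U(h(y, r), r) - r y\<close> in the coordinates \<open>(y, r)\<close> of the source. This form avoids differentiating \<open>g\<close>:
  its derivative is \<open>\<eta> dh + g dr - r dy - y dr = \<eta> dh - r dy\<close>.
\<close>
lemma exact_symplectic_twist:
  assumes "Ck 1 g" "Ck 1 \<eta>" shows "exact_symplectic (descend (twist g \<eta>))"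
proof -
  have "Ck (Suc 0) h" "Ck (Suc 0) \<eta>"
    using Ck_h[OF assms(1)] assms(2) by (simp_all only: One_nat_def)
  then obtain a b c d where h: "has_partials h a b" and \<eta>: "has_partials \<eta> c d"
    by (elim Ck_SucE)
  define s where "s = (\<lambda>z. U (h z, snd z) - snd z * fst z)"
  note U_h = has_partials_compose[OF U h has_partials_snd]
  note \<eta>_h = has_partials_compose[OF \<eta> h has_partials_snd]
  note twist' = has_derivative_Pair[OF has_partialsD[OF h] has_partialsD[OF \<eta>_h]]
  show ?thesis
  proof (rule exact_symplectic_descend[OF equivariant_twist])
    show "(twist g \<eta> has_derivative (\<lambda>v. (fst v * a w + snd v * b w,
        fst v * (a w * c (h w, snd w) + 0 * d (h w, snd w)) +
        snd v * (b w * c (h w, snd w) + 1 * d (h w, snd w))))) (at w)" for w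
      unfolding twist_def by (rule twist')
    show "(s has_derivative (\<lambda>v. snd (twist g \<eta> w) *
        fst (fst v * a w + snd v * b w,
          fst v * (a w * c (h w, snd w) + 0 * d (h w, snd w)) +
          snd v * (b w * c (h w, snd w) + 1 * d (h w, snd w))) - snd w * fst v)) (at w)" for w
      unfolding s_def
      by (auto intro!: derivative_eq_intros has_partialsD[OF U_h]
          simp: g_h twist_def algebra_simps)
    show "s (x + 1, r) = s (x, r)" for x r
    proof -
      have "h (x + 1, r) = h (x, r) + 1"
        using equivariant_twist by (simp add: equivariant_def twist_def)
      then show ?thesis
        unfolding s_def fst_conv snd_conv by (simp only: quasi_periodic) (simp add: algebra_simps)
    qed
  qed
qed

text \<open>
  The required form of the map: the second component is the value of \<open>\<eta>\<close> over the first
  component. Periodicity of \<open>\<eta>\<close> makes the chosen representative of the circle irrelevant.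
\<close>
lemma twist_factors:
  "descend (twist g \<eta>) (\<theta>, r) =
    (fst (descend (twist g \<eta>) (\<theta>, r)), \<eta> (lift_point (fst (descend (twist g \<eta>) (\<theta>, r)), r)))"
proof -
  obtain w where w: "cover w = (\<theta>, r)" using surj_cover by blast
  then have r: "snd w = r" by (auto simp: cover_def split: prod.splits)
  have "\<eta> (lift_point (cover (h w, r))) = \<eta> (h w, r)"
    by (rule periodic_lift_point[OF periodic_\<eta>])
  then show ?thesis
    unfolding w[symmetric] descend_cover[OF equivariant_twist]
    by (simp add: twist_def cover_def r)
qed

text \<open>
  Averaging \<open>U\<close> in \<open>r\<close> averages \<open>\<eta>\<close> and replaces \<open>g\<close> by a difference quotient of \<open>U\<close>. The common
  mixed derivative becomes the difference quotient of \<open>\<eta>\<close>, which is positive because \<open>\<eta>\<close> increases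
  in \<open>r\<close>.
\<close>
lemma generating_function_average:
  assumes \<epsilon>: "\<epsilon> > 0" and \<eta>: "Ck 1 \<eta>"
  shows "generating_function (centred_dq \<epsilon> (prim_r U)) (centred_dq \<epsilon> (prim_r \<eta>)) (centred_dq \<epsilon> U) (centred_dq \<epsilon> \<eta>)"
proof
  obtain c d where cd: "has_partials \<eta> c d" "continuous_on UNIV c"
    using \<eta> unfolding One_nat_def by (rule Ck_SucE) simp
  have V: "has_partials (centred_dq \<epsilon> (prim_r \<eta>)) (centred_dq \<epsilon> (prim_r c)) (centred_dq \<epsilon> \<eta>)"
    by (intro has_partials_centred_dq has_partials_prim_r[OF cd])
  show W: "has_partials (centred_dq \<epsilon> (prim_r U)) (centred_dq \<epsilon> (prim_r \<eta>)) (centred_dq \<epsilon> U)"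
    by (intro has_partials_centred_dq has_partials_prim_r[OF U cont_\<eta>])
  show "((\<lambda>x. centred_dq \<epsilon> U (x, r)) has_real_derivative centred_dq \<epsilon> \<eta> (x, r)) (at x)" for x r
    by (rule has_partials_x[OF has_partials_centred_dq[OF U]])
  show "((\<lambda>r. centred_dq \<epsilon> (prim_r \<eta>) (x, r)) has_real_derivative centred_dq \<epsilon> \<eta> (x, r)) (at r)" for x r
    by (rule has_partials_r[OF V])
  show "centred_dq \<epsilon> \<eta> z > 0" for z
    using strict_mono_less[OF mono_\<eta>, of "fst z" "snd z - \<epsilon>" "snd z + \<epsilon>"] \<epsilon>
    by (simp add: centred_dq_def)
  show "continuous_on UNIV (centred_dq \<epsilon> (prim_r \<eta>))" by (rule has_partials_continuous[OF V])
  show "continuous_on UNIV (centred_dq \<epsilon> U)" by (rule has_partials_continuous[OF has_partials_centred_dq[OF U]])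
  show "centred_dq \<epsilon> (prim_r U) (x + 1, r) = centred_dq \<epsilon> (prim_r U) (x, r) + r" for x r
  proof -
    \<comment> \<open>The average of \<open>r\<close> over a centred segment is \<open>r\<close>: the quadratic terms of the shift below
      leave exactly \<open>((r + \<epsilon>)\<^sup>2 - (r - \<epsilon>)\<^sup>2) / (4\<epsilon>) = r\<close>.\<close>
    have shift: "prim_r U (x + 1, r) = prim_r U (x, r) + r\<^sup>2 / 2" for r
    proof -
      have "((\<lambda>r. prim_r U (x + 1, r) - prim_r U (x, r) - r\<^sup>2 / 2) has_real_derivative 0) (at r)" for r
        by (auto intro!: derivative_eq_intros prim_r_deriv_r has_partials_continuous[OF U]
            simp: quasi_periodic)
      from DERIV_isconst_all[OF allI[OF this], of r 0]
      show ?thesis by simp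
    qed
    show ?thesis
      unfolding centred_dq_def fst_conv snd_conv shift using \<epsilon>
      by (simp add: field_simps power2_eq_square)
  qed
  show "\<exists>r. centred_dq \<epsilon> (prim_r \<eta>) (x, r) = y" for x y
  proof -
    let ?f = "\<lambda>r. centred_dq \<epsilon> (prim_r \<eta>) (x, r)"
    obtain r where r: "\<eta> (x, r) = y" using surj_\<eta> by blast
    \<comment> \<open>An average of \<open>\<eta>\<close> lies between the values at the two ends of the segment, so the averaged
      function still takes all values.\<close>
    have less: "?f s < \<eta> (x, s + \<epsilon>)" "\<eta> (x, s - \<epsilon>) < ?f s" for s
    proof -
      obtain t where "\<bar>t - snd (x, s)\<bar> < \<epsilon>" "?f s = \<eta> (fst (x, s), t)"
        by (rule centred_dq_mvt[where A = "prim_r \<eta>" and B = \<eta> and \<epsilon> = \<epsilon> and z = "(x, s)"])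
          (rule \<epsilon>, rule prim_r_deriv_r[OF cont_\<eta>], rule that)
      then have "\<bar>t - s\<bar> < \<epsilon>" "?f s = \<eta> (x, t)" by simp_all
      then show "?f s < \<eta> (x, s + \<epsilon>)" "\<eta> (x, s - \<epsilon>) < ?f s"
        by (auto simp: strict_mono_less[OF mono_\<eta>])
    qed
    have "?f (r - \<epsilon>) \<le> y" "y \<le> ?f (r + \<epsilon>)"
      using less[of "r - \<epsilon>"] less[of "r + \<epsilon>"] r by simp_all
    moreover have "continuous_on {r - \<epsilon>..r + \<epsilon>} ?f"
      by (intro continuous_on_compose2[OF has_partials_continuous[OF V]] continuous_intros) auto
    ultimately show ?thesis using IVT'[of ?f "r - \<epsilon>" y "r + \<epsilon>"] \<epsilon> by auto
  qed
qed

text \<open>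
  The gain: the averaged data are \<open>C\<^sup>1\<close> even where \<open>g\<close> is only continuous, because \<open>U\<close> is \<open>C\<^sup>1\<close>
  with derivatives \<open>\<eta>\<close> and \<open>g\<close>.
\<close>
lemma Ck_average:
  assumes "Ck 1 \<eta>"
  shows "Ck 1 (centred_dq \<epsilon> U)" "Ck 1 (centred_dq \<epsilon> (prim_r \<eta>))"
proof -
  have "Ck (Suc 0) U"
    by (rule Ck_SucI[OF U]) (simp_all add: cont_\<eta> cont_g)
  then show "Ck 1 (centred_dq \<epsilon> U)" unfolding One_nat_def by (rule Ck_centred_dq)
  show "Ck 1 (centred_dq \<epsilon> (prim_r \<eta>))" by (intro Ck_centred_dq Ck_prim_r assms)
qed

text \<open>
  Index and point vary together, which is continuous convergence. By the mean value theorem the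
  averaged \<open>g\<close> and \<open>\<eta>\<close> converge in this sense, and then so does the fibrewise inverse of \<open>g\<close>.
\<close>
lemma tendsto_twist_average:
  fixes \<epsilon> :: "nat \<Rightarrow> real"
  assumes \<epsilon>: "\<And>n. \<epsilon> n > 0" "\<epsilon> \<longlonglongrightarrow> 0" and \<eta>: "Ck 1 \<eta>"
  shows "((\<lambda>(n, u). twist (centred_dq (\<epsilon> n) U) (centred_dq (\<epsilon> n) (prim_r \<eta>)) u) \<longlongrightarrow> twist g \<eta> w)
    (sequentially \<times>\<^sub>F nhds w)"
proof -
  let ?F = "sequentially \<times>\<^sub>F nhds w"
  define hs where "hs = (\<lambda>\<xi>. fibre_inverse (centred_dq (\<epsilon> (fst \<xi>)) U) (snd \<xi>))"
  have \<epsilon>_lim: "((\<lambda>\<xi>. \<epsilon> (fst \<xi>)) \<longlongrightarrow> 0) ?F"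
    by (rule filterlim_compose[OF \<epsilon>(2) filterlim_fst])
  have "(snd \<longlongrightarrow> w) ?F" by (rule filterlim_snd)
  then have lim: "((\<lambda>\<xi>. fst (snd \<xi>)) \<longlongrightarrow> fst w) ?F" "((\<lambda>\<xi>. snd (snd \<xi>)) \<longlongrightarrow> snd w) ?F"
    by (rule tendsto_fst, rule tendsto_snd)
  have gf: "generating_function (centred_dq (\<epsilon> n) (prim_r U)) (centred_dq (\<epsilon> n) (prim_r \<eta>))
      (centred_dq (\<epsilon> n) U) (centred_dq (\<epsilon> n) \<eta>)" for n
    by (rule generating_function_average[OF \<epsilon>(1) \<eta>])
  have hs_lim: "(hs \<longlongrightarrow> h w) ?F"
  proof (rule tendsto_of_strict_mono_tendsto[OF mono_g])
    show "strict_mono (\<lambda>x. centred_dq (\<epsilon> (fst \<xi>)) U (x, snd (snd \<xi>)))" for \<xi> :: "nat \<times> real \<times> real"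
      by (rule generating_function.mono_g[OF gf])
    show "((\<lambda>\<xi>. centred_dq (\<epsilon> (fst \<xi>)) U (x, snd (snd \<xi>))) \<longlongrightarrow> g (x, snd w)) ?F" for x
      by (rule tendsto_centred_dq[OF has_partials_r[OF U] cont_g \<epsilon>(1) \<epsilon>_lim tendsto_const lim(2)])
    show "((\<lambda>\<xi>. centred_dq (\<epsilon> (fst \<xi>)) U (hs \<xi>, snd (snd \<xi>))) \<longlongrightarrow> g (h w, snd w)) ?F"
      unfolding hs_def generating_function.g_h[OF gf] g_h by (rule lim(1))
  qed
  have "((\<lambda>\<xi>. centred_dq (\<epsilon> (fst \<xi>)) (prim_r \<eta>) (hs \<xi>, snd (snd \<xi>))) \<longlongrightarrow> \<eta> (h w, snd w)) ?F"
    by (rule tendsto_centred_dq[OF prim_r_deriv_r[OF cont_\<eta>] cont_\<eta> \<epsilon>(1) \<epsilon>_lim hs_lim lim(2)])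
  from tendsto_Pair[OF hs_lim this] show ?thesis
    by (simp add: twist_def hs_def case_prod_beta')
qed

lemma exact_symplectic_homeo_twist:
  assumes "Ck 1 \<eta>" shows "exact_symplectic_homeo (descend (twist g \<eta>))"
proof -
  define \<epsilon> where "\<epsilon> n = inverse (real (Suc n))" for n
  have \<epsilon>: "\<epsilon> n > 0" for n by (simp add: \<epsilon>_def)
  have \<epsilon>_lim: "\<epsilon> \<longlonglongrightarrow> 0" unfolding \<epsilon>_def by (rule LIMSEQ_inverse_real_of_nat)
  define Fs where "Fs n = twist (centred_dq (\<epsilon> n) U) (centred_dq (\<epsilon> n) (prim_r \<eta>))" for n
  have gf: "generating_function (centred_dq (\<epsilon> n) (prim_r U)) (centred_dq (\<epsilon> n) (prim_r \<eta>))
      (centred_dq (\<epsilon> n) U) (centred_dq (\<epsilon> n) \<eta>)" for n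
    by (rule generating_function_average[OF \<epsilon> assms])
  note C1 = Ck_average[OF assms]
  have "Ck_diffeo 1 (descend (Fs n)) \<and> exact_symplectic (descend (Fs n))" for n
    unfolding Fs_def
    by (intro conjI generating_function.Ck_diffeo_twist[OF gf]
        generating_function.exact_symplectic_twist[OF gf] C1)
  moreover have "limitin compact_open_topology (\<lambda>n. descend (Fs n)) (descend (twist g \<eta>)) sequentially"
  proof (rule limitin_compact_open_descend[OF equivariant_twist])
    show "continuous_on UNIV (twist g \<eta>)"
      using Ck_twist[of 0] cont_g cont_\<eta> by simp
    show "equivariant (Fs n)" for n
      unfolding Fs_def by (rule generating_function.equivariant_twist[OF gf])
    show "continuous_on UNIV (Fs n)" for n
      using generating_function.Ck_twist[OF gf[of n], of 0]
        generating_function.cont_g[OF gf[of n]] generating_function.cont_\<eta>[OF gf[of n]]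
      by (simp add: Fs_def)
    show "((\<lambda>(n, u). Fs n u) \<longlongrightarrow> twist g \<eta> w) (sequentially \<times>\<^sub>F nhds w)" for w
      unfolding Fs_def by (rule tendsto_twist_average[OF \<epsilon> \<epsilon>_lim assms])
  qed
  moreover have "homeomorphism UNIV UNIV (descend (twist g \<eta>)) (inv (descend (twist g \<eta>)))"
    using Ck_diffeo_twist[of 0] cont_g cont_\<eta> by (simp add: Ck_diffeo_0_iff)
  ultimately show ?thesis
    unfolding exact_symplectic_homeo_def
    by (intro conjI exI[of _ "\<lambda>n. descend (Fs n)"]) simp_all
qed

end

section \<open>The generating function of a foliation\<close>

text \<open>
  The local representatives of \<open>\<phi>\<close> differ by integers in the first component only, so their second
  components fit together.
\<close>
lemma Ck_snd_of_Ck_map: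
  assumes "Ck_map k \<phi>" shows "Ck k (\<lambda>w. snd (\<phi> (cover w)))"
proof (rule Ck_on_locally)
  fix w
  obtain V F where V: "open V" "w \<in> V" "Ck_on k V F" "\<And>u. u \<in> V \<Longrightarrow> \<phi> (cover u) = cover (F u)"
    using assms[unfolded Ck_map_def, rule_format, of w] by (elim exE conjE) blast
  have "Ck_on k V (\<lambda>w. snd (\<phi> (cover w)))"
  proof (rule Ck_on_cong[OF V(1)])
    show "Ck_on k V (\<lambda>u. snd (F u))"
      by (rule Ck_on_bounded_linear[OF V(1) bounded_linear_snd V(3)])
    show "snd (F u) = snd (\<phi> (cover u))" if "u \<in> V" for u
      unfolding V(4)[OF that] by (simp add: cover_def case_prod_beta)
  qed
  then show "\<exists>V. open V \<and> w \<in> V \<and> Ck_on k V (\<lambda>w. snd (\<phi> (cover w)))"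
    using V(1,2) by (intro exI conjI)
qed

text \<open>
  \<open>P(x, a)\<close> is the lift of \<open>f a\<close> or of \<open>f (- a)\<close>. The chain rule applied to the inverse
  diffeomorphism shows that the derivative in the parameter does not vanish; as the plane is
  connected it has a constant sign, which a reversal of the parameter makes positive.
  \<open>B\<close> gives the parameter of the leaf through a point.
\<close>
lemma foliation_parametrization:
  assumes k: "k \<ge> 1" and f: "Ck_foliation_in_graphs k f"
  obtains P p q B :: "real \<times> real \<Rightarrow> real" where
    "Ck k P" "has_partials P p q" "continuous_on UNIV q" "\<And>z. q z > 0"
    "\<And>x a. P (x + 1, a) = P (x, a)"
    "continuous_on UNIV B" "\<And>x y. P (x, B (x, y)) = y"
    "\<And>a. \<exists>b. \<forall>x. P (x, a) = f b (to_circle x)"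
proof -
  define \<phi> where "\<phi> = (\<lambda>(\<theta>, a). (\<theta>, f a \<theta>))"
  have bij: "bij \<phi>" and Ck\<phi>: "Ck_map k \<phi>" "Ck_map k (inv \<phi>)"
    using f unfolding Ck_foliation_in_graphs_def Ck_diffeo_def \<phi>_def by blast+
  define P where "P = (\<lambda>w. snd (\<phi> (cover w)))"
  define A where "A = (\<lambda>w. snd (inv \<phi> (cover w)))"
  have P: "Ck k P" and A: "Ck k A"
    unfolding P_def A_def by (intro Ck_snd_of_Ck_map Ck\<phi>)+
  have P_eq: "P (x, a) = f a (to_circle x)" for x a
    by (simp add: P_def \<phi>_def cover_def)
  have cover_P: "\<phi> (cover (x, a)) = cover (x, P (x, a))" for x a
    by (simp add: P_def \<phi>_def cover_def)
  have AP: "A (x, P (x, a)) = a" for x a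
  proof -
    have "A (x, P (x, a)) = snd (inv \<phi> (\<phi> (cover (x, a))))"
      by (simp only: A_def cover_P)
    then show ?thesis by (simp add: inv_f_f[OF bij_is_inj[OF bij]] cover_def)
  qed
  have PA: "P (x, A (x, y)) = y" for x y
  proof -
    obtain \<theta> a where a: "inv \<phi> (cover (x, y)) = (\<theta>, a)" by fastforce
    have "\<phi> (\<theta>, a) = cover (x, y)"
      unfolding a[symmetric] by (rule surj_f_inv_f[OF bij_is_surj[OF bij]])
    then have "f a (to_circle x) = y" by (auto simp: \<phi>_def cover_def)
    moreover have "A (x, y) = a" by (simp add: A_def a)
    ultimately show ?thesis by (simp add: P_eq)
  qed
  obtain j where j: "k = Suc j" using k by (cases k) auto
  obtain p q where pq: "has_partials P p q" "Ck j p" "Ck j q"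
    using P unfolding j by (rule Ck_SucE)
  obtain c d where cd: "has_partials A c d" "Ck j c" "Ck j d"
    using A unfolding j by (rule Ck_SucE)
  have q_nz: "q (x, a) \<noteq> 0" for x a
  proof -
    have "((\<lambda>a. A (x, P (x, a))) has_real_derivative d (x, P (x, a)) * q (x, a)) (at a)"
      by (rule DERIV_chain2[OF has_partials_r[OF cd(1)] has_partials_r[OF pq(1)]])
    moreover have "((\<lambda>a. A (x, P (x, a))) has_real_derivative 1) (at a)"
      unfolding AP by (rule DERIV_ident)
    ultimately have "d (x, P (x, a)) * q (x, a) = 1" by (rule DERIV_unique)
    then show ?thesis by auto
  qed
  have q: "continuous_on UNIV q" by (rule Ck_continuous[OF pq(3)])
  have "connected (range q)"
    by (rule connected_continuous_image[OF q]) (rule connected_UNIV)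
  then have "0 \<in> range q" if "q z \<le> 0" "0 \<le> q w" for z w
    using that by (rule connectedD_interval[OF _ rangeI rangeI])
  moreover have "0 \<notin> range q" using q_nz by fastforce
  ultimately have sign: "(\<forall>z. q z > 0) \<or> (\<forall>z. q z < 0)"
    by (meson linorder_not_less order_less_imp_le)
  define \<sigma> :: real where "\<sigma> = (if \<forall>z. q z > 0 then 1 else -1)"
  have \<sigma>: "\<sigma> * \<sigma> = 1" by (simp add: \<sigma>_def)
  have \<sigma>_q: "\<sigma> * q z > 0" for z
  proof (cases "\<forall>z. q z > 0")
    case True
    then show ?thesis unfolding \<sigma>_def by (simp only: if_True mult_1 simp_thms)
  next
    case False
    then have "\<sigma> = -1" "q z < 0" using sign unfolding \<sigma>_def by (simp_all only: if_False) blast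
    then show ?thesis by simp
  qed
  have "has_partials (\<lambda>z. \<sigma> * snd z) (\<lambda>z. 0) (\<lambda>z. \<sigma>)"
    by (auto simp: has_partials_def intro!: derivative_eq_intros)
  note partials = has_partials_compose[OF pq(1) has_partials_fst this]
  have Ck\<sigma>: "Ck k (\<lambda>z. \<sigma> * snd z)" by (intro Ck_mult Ck_const Ck_snd)
  show thesis
  proof (rule that[where B = "\<lambda>z. \<sigma> * A z", OF _ partials])
    show "Ck k (\<lambda>z. P (fst z, \<sigma> * snd z))" by (intro Ck_compose P Ck_fst Ck\<sigma>)
    show "continuous_on UNIV (\<lambda>z. 0 * p (fst z, \<sigma> * snd z) + \<sigma> * q (fst z, \<sigma> * snd z))"
      by (intro continuous_intros continuous_on_compose2[OF q] continuous_on_compose2[OF Ck_continuous[OF pq(2)]]) auto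
    show "0 * p (fst z, \<sigma> * snd z) + \<sigma> * q (fst z, \<sigma> * snd z) > 0" for z
      using \<sigma>_q by simp
    show "P (fst (x + 1, a), \<sigma> * snd (x + 1, a)) = P (fst (x, a), \<sigma> * snd (x, a))" for x a
    proof -
      have "to_circle (x + 1) = to_circle x" by (simp add: to_circle_eq_iff)
      then show ?thesis by (simp add: P_eq)
    qed
    show "continuous_on UNIV (\<lambda>z. \<sigma> * A z)"
      by (intro continuous_intros Ck_continuous[OF A])
    show "P (fst (x, \<sigma> * A (x, y)), \<sigma> * snd (x, \<sigma> * A (x, y))) = y" for x y
      using \<sigma> by (simp add: PA flip: mult.assoc)
    show "\<exists>b. \<forall>x. P (fst (x, a), \<sigma> * snd (x, a)) = f b (to_circle x)" for a
      by (auto simp: P_eq)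
  qed
qed

text \<open>
  The leaf whose parameter is the maximum of \<open>B\<close> along \<open>[0, 1] \<times> {y}\<close> lies at or above height \<open>y\<close>, and
  so has mean at least \<open>y\<close>; the minimum gives mean at most \<open>y\<close>.
\<close>
lemma mean_surj:
  fixes P B :: "real \<times> real \<Rightarrow> real"
  assumes P: "continuous_on UNIV P" and mono: "\<And>x. strict_mono (\<lambda>a. P (x, a))"
    and B: "continuous_on UNIV B" and PB: "\<And>x y. P (x, B (x, y)) = y"
  shows "\<exists>a. prim_x P (1, a) = y"
proof -
  have cB: "continuous_on {0..1} (\<lambda>x. B (x, y))"
    by (intro continuous_on_compose2[OF B] continuous_intros) auto
  have "\<exists>x\<^sub>1\<in>{0..1}. \<forall>x\<in>{0..1}. B (x, y) \<le> B (x\<^sub>1, y)"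
    by (rule continuous_attains_sup[OF _ _ cB]) auto
  then obtain x\<^sub>1 where x1: "\<And>x. x \<in> {0..1} \<Longrightarrow> B (x, y) \<le> B (x\<^sub>1, y)"
    by blast
  have "\<exists>x\<^sub>0\<in>{0..1}. \<forall>x\<in>{0..1}. B (x\<^sub>0, y) \<le> B (x, y)"
    by (rule continuous_attains_inf[OF _ _ cB]) auto
  then obtain x\<^sub>0 where x0: "\<And>x. x \<in> {0..1} \<Longrightarrow> B (x\<^sub>0, y) \<le> B (x, y)"
    by blast
  have le: "P (x, a) \<le> P (x, b) \<longleftrightarrow> a \<le> b" for x a b
    using strict_mono_less_eq[OF mono] .
  have int: "(\<lambda>t. P (t, a)) integrable_on {0..1}" for a
    by (intro integrable_continuous_interval continuous_on_compose2[OF P] continuous_intros) auto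
  have mean: "prim_x P (1, a) = integral {0..1} (\<lambda>t. P (t, a))" for a
    by (simp add: prim_x_def)
  have "prim_x P (1, B (x\<^sub>0, y)) \<le> integral {0..1} (\<lambda>t::real. y)"
    unfolding mean
  proof (rule integral_le)
    show "(\<lambda>t. P (t, B (x\<^sub>0, y))) integrable_on {0..1}" "(\<lambda>t::real. y) integrable_on {0..1}"
      by (rule int, simp add: integrable_const_ivl)
    fix x :: real assume "x \<in> {0..1}"
    then show "P (x, B (x\<^sub>0, y)) \<le> y" using x0 le[of x _ "B (x, y)"] by (simp add: PB)
  qed
  moreover have "integral {0..1} (\<lambda>t::real. y) \<le> prim_x P (1, B (x\<^sub>1, y))"
    unfolding mean
  proof (rule integral_le)
    show "(\<lambda>t::real. y) integrable_on {0..1}" "(\<lambda>t. P (t, B (x\<^sub>1, y))) integrable_on {0..1}"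
      by (simp add: integrable_const_ivl, rule int)
    fix x :: real assume "x \<in> {0..1}"
    then show "y \<le> P (x, B (x\<^sub>1, y))" using x1 le[of x "B (x, y)"] by (simp add: PB)
  qed
  moreover have "B (x\<^sub>0, y) \<le> B (x\<^sub>1, y)" using x0[of 0] x1[of 0] by simp
  moreover have "continuous_on {B (x\<^sub>0, y)..B (x\<^sub>1, y)} (\<lambda>a. prim_x P (1, a))"
    by (intro continuous_on_compose2[OF continuous_prim_x[OF P]] continuous_intros) auto
  ultimately show ?thesis
    using IVT'[of "\<lambda>a. prim_x P (1, a)" "B (x\<^sub>0, y)" y "B (x\<^sub>1, y)"] by auto
qed

text \<open>
  The foliation is parametrized by the mean height of its leaves, which turns the mean of
  \<open>\<eta>(\<cdot>, r)\<close> into the quasi-periodicity of its primitive.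
\<close>
lemma foliation_generating_function:
  assumes k: "k = Suc j" and f: "Ck_foliation_in_graphs k f"
  obtains U \<eta> g q where "generating_function U \<eta> g q" "Ck j g" "Ck k \<eta>"
    "\<And>r. \<exists>b. \<forall>x. \<eta> (x, r) = f b (to_circle x)"
proof -
  have "k \<ge> 1" using k by simp
  then obtain P p q B where P: "Ck k P" "has_partials P p q" "continuous_on UNIV q" "\<And>z. q z > 0"
    and per: "\<And>x a. P (x + 1, a) = P (x, a)"
    and B: "continuous_on UNIV B" "\<And>x y. P (x, B (x, y)) = y"
    and leaf: "\<And>a. \<exists>b. \<forall>x. P (x, a) = f b (to_circle x)"
    using foliation_parametrization[OF _ f] by blast
  \<comment> \<open>The mean as a function on the plane, constant in the second variable, so that its inverse
    \<open>b\<close> is as smooth as \<open>P\<close> by the result on fibrewise inverses.\<close>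
  define C where "C = (\<lambda>z::real \<times> real. prim_x P (1, fst z))"
  define C' where "C' = (\<lambda>z::real \<times> real. prim_x q (1, fst z))"
  define b where "b = (\<lambda>r. fibre_inverse C (r, 0))"
  have C'_pos: "C' z > 0" for z
    using strict_monoD[OF strict_mono_if_deriv_pos[OF prim_x_deriv_x[OF P(3)] P(4)], of 0 1]
    by (simp add: C'_def)
  have C: "Ck k C"
    unfolding C_def by (intro Ck_compose[OF Ck_prim_x[OF P(1)]] Ck_const Ck_fst)
  have C_partials: "has_partials C (\<lambda>z. 0 * P (1, fst z) + 1 * C' z) (\<lambda>z. 0 * P (1, fst z) + 0 * C' z)"
    unfolding C_def C'_def
    by (rule has_partials_compose[OF has_partials_prim_x[OF P(2,3)] has_partials_const has_partials_fst])
  have C_x: "((\<lambda>x. C (x, r)) has_real_derivative C' (x, r)) (at x)" for x r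
    using has_partials_x[OF C_partials, of r x] by simp
  have mono_P: "strict_mono (\<lambda>a. P (x, a))" for x
    by (rule strict_mono_if_deriv_pos[OF has_partials_r[OF P(2)] P(4)])
  have mono_C: "strict_mono (\<lambda>x. C (x, r))" for r
    by (rule strict_mono_if_deriv_pos[OF C_x C'_pos])
  have C_b: "C (fibre_inverse C z, snd z) = fst z" for z
    using mean_surj[OF Ck_continuous[OF P(1)] mono_P B]
    by (intro fibre_inverse mono_C) (simp add: C_def)
  have prim_b: "prim_x P (1, b r) = r" for r
    using C_b[of "(r, 0)"] by (simp add: b_def C_def)
  have b_prim: "b (prim_x P (1, a)) = a" for a
    using fibre_inverse_eqI[where z = "(prim_x P (1, a), 0)", OF mono_C, of a] by (simp add: b_def C_def)
  have Ck_inv: "Ck k (fibre_inverse C)"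
    by (rule Ck_fibred_inverse[OF C C_x C'_pos C_b])
  have Ckb: "Ck k (\<lambda>z. b (snd z))"
    unfolding b_def by (intro Ck_compose[OF Ck_inv] Ck_snd Ck_const)
  have "(0 * P (1, fst z) + 1 * C' z) \<noteq> 0" for z using C'_pos[of z] by simp
  from has_partials_fibred_inverse[OF C_partials this Ck_continuous[OF Ck_inv] C_b]
  have b': "(b has_real_derivative inverse (C' (b r, 0))) (at r)" for r
    unfolding b_def by (drule_tac has_partials_x[where r = 0 and x = r]) simp
  define \<eta> where "\<eta> = (\<lambda>z. P (fst z, b (snd z)))"
  have \<eta>: "Ck k \<eta>" unfolding \<eta>_def by (intro Ck_compose[OF P(1)] Ck_fst Ckb)
  obtain c d where cd: "has_partials \<eta> c d" "Ck j c" "Ck j d"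
    using \<eta> unfolding k by (rule Ck_SucE)
  have "((\<lambda>r. \<eta> (x, r)) has_real_derivative q (x, b r) * inverse (C' (b r, 0))) (at r)" for x r
    unfolding \<eta>_def fst_conv snd_conv
    by (rule DERIV_chain2[OF has_partials_r[OF P(2)] b'])
  from DERIV_unique[OF has_partials_r[OF cd(1)] this]
  have d_eq: "d (x, r) = q (x, b r) * inverse (C' (b r, 0))" for x r .
  have d_pos: "d z > 0" for z
    using P(4) C'_pos by (cases z) (simp add: d_eq)
  have per_\<eta>: "\<eta> (x + 1, r) = \<eta> (x, r)" for x r by (simp add: \<eta>_def per)
  have c\<eta>: "continuous_on UNIV \<eta>" and cd': "continuous_on UNIV d"
    using Ck_continuous \<eta> cd(3) by blast+
  have "generating_function (prim_x \<eta>) \<eta> (prim_x d) d"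
  proof
    show "has_partials (prim_x \<eta>) \<eta> (prim_x d)" by (rule has_partials_prim_x[OF cd(1) cd'])
    show "prim_x \<eta> (x + 1, r) = prim_x \<eta> (x, r) + r" for x r
    proof -
      have "((\<lambda>x. prim_x \<eta> (x + 1, r)) has_real_derivative \<eta> (x, r)) (at x)" for x
        using prim_x_deriv_x[OF c\<eta>, of r "x + 1"] by (simp add: DERIV_shift per_\<eta>)
      from DERIV_diff[OF this prim_x_deriv_x[OF c\<eta>, of r]]
      have "((\<lambda>x. prim_x \<eta> (x + 1, r) - prim_x \<eta> (x, r)) has_real_derivative 0) (at x)" for x
        by simp
      from DERIV_isconst_all[OF allI[OF this], of x 0]
      have "prim_x \<eta> (x + 1, r) - prim_x \<eta> (x, r) = prim_x \<eta> (1, r)" by simp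
      also have "prim_x \<eta> (1, r) = prim_x P (1, b r)" by (simp add: prim_x_def \<eta>_def)
      finally show ?thesis by (simp add: prim_b)
    qed
    show "((\<lambda>x. prim_x d (x, r)) has_real_derivative d (x, r)) (at x)" for x r
      by (rule prim_x_deriv_x[OF cd'])
    show "((\<lambda>r. \<eta> (x, r)) has_real_derivative d (x, r)) (at r)" for x r
      by (rule has_partials_r[OF cd(1)])
    show "d z > 0" for z by (rule d_pos)
    show "continuous_on UNIV \<eta>" by (rule c\<eta>)
    show "continuous_on UNIV (prim_x d)" by (rule continuous_prim_x[OF cd'])
    show "\<exists>r. \<eta> (x, r) = y" for x y
      by (rule exI[of _ "prim_x P (1, B (x, y))"]) (simp add: \<eta>_def b_prim B(2))
  qed
  then show thesis
    by (rule that[OF _ Ck_prim_x[OF cd(3)] \<eta>]) (simp add: \<eta>_def leaf)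
qed

theorem corollary1p3:
  fixes k :: nat and f :: "real \<Rightarrow> circle \<Rightarrow> real"
  assumes "k \<ge> 1" and "Ck_foliation_in_graphs k f"
  shows "\<exists>(\<Phi> :: annulus \<Rightarrow> annulus) (h :: annulus \<Rightarrow> circle) (\<eta> :: annulus \<Rightarrow> real).
    exact_symplectic_Ck_diffeo (k - 1) \<Phi> \<and>
    (\<forall>\<theta> r. \<Phi> (\<theta>, r) = (h (\<theta>, r), \<eta> (h (\<theta>, r), r))) \<and>
    (\<forall>r. {(\<theta>, \<eta> (\<theta>, r)) | \<theta>. True} \<in> leaves f)"
proof -
  obtain j where k: "k = Suc j" using assms(1) by (cases k) auto
  obtain U \<eta> g q where gf: "generating_function U \<eta> g q"
    and g: "Ck j g" and \<eta>: "Ck k \<eta>" and leaf: "\<And>r. \<exists>a. \<forall>x. \<eta> (x, r) = f a (to_circle x)"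
    using foliation_generating_function[OF k assms(2)] by blast
  interpret generating_function U \<eta> g q by (rule gf)
  let ?\<Phi> = "descend (twist g \<eta>)"
  have \<eta>_1: "Ck 1 \<eta>" and \<eta>_j: "Ck j \<eta>"
    using Ck_mono[OF \<eta>] k by (simp_all del: Ck_on.simps One_nat_def)
  have "exact_symplectic_Ck_diffeo j ?\<Phi>"
  proof (cases "j = 0")
    case True
    then show ?thesis
      using exact_symplectic_homeo_twist[OF \<eta>_1] by (simp add: exact_symplectic_Ck_diffeo_def)
  next
    case False
    then have "Ck 1 g" by (intro Ck_mono[OF g]) simp
    from exact_symplectic_twist[OF this \<eta>_1] Ck_diffeo_twist[OF g \<eta>_j] False show ?thesis
      by (simp add: exact_symplectic_Ck_diffeo_def)
  qed
  moreover have "{(\<theta>, \<eta> (lift_point (\<theta>, r))) | \<theta>. True} \<in> leaves f" for r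
  proof -
    obtain a where a: "\<And>x. \<eta> (x, r) = f a (to_circle x)" using leaf by blast
    have "\<eta> (lift_point (\<theta>, r)) = f a \<theta>" for \<theta>
      by (simp add: lift_point_def a Quotient_abs_rep[OF Quotient_circle])
    then show ?thesis by (auto simp: leaves_def graph_def)
  qed
  ultimately show ?thesis
    using twist_factors k
    by (intro exI[of _ ?\<Phi>] exI[of _ "\<lambda>z. fst (?\<Phi> z)"] exI[of _ "\<lambda>z. \<eta> (lift_point z)"]) simp
qed

end
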